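(* Let $0\le i\le g$ be integers. The cokernel of the map $$\wedge\,\tfrac{\omega^i}{i!}:\Lambda^{g-i}(\mathbb Z^{2g})\to\Lambda^{g+i}(\mathbb Z^{2g})$$ admits an $\mathrm{Sp}(2g)$-invariant $\mathbb Z$-split filtration whose associated graded modules are, as $\mathrm{Sp}(2g)$-modules, $$\mathrm{gr}_r\,\mathrm{coker}(\omega^i/i!)\cong P^{g-i-2r}(\mathbb Z^{2g})\Big/\tbinom{r+i}{i}\qquad\text{for } 0\le r\le \lfloor\tfrac{g-i}{2}\rfloor,$$ and $\mathrm{gr}_r\,\mathrm{coker}(\omega^i/i!)=0$ for all other $r$.
   Context: $\mathbb Z^{2g}$ has standard basis $e^1,\dots,e^{2g}$ and symplectic element $\omega = e^1\wedge e^2+\cdots+e^{2g-1}\wedge e^{2g}\in\Lambda^2(\mathbb Z^{2g})$; $\omega^i/i!$ is an integral form. $\mathrm{Sp}(2g)=\mathrm{Sp}(2g,\mathbb Z)$ acts on $\Lambda^*(\mathbb Z^{2g})$ and fixes $\omega$. For $0\le k\le g$, $P^k(\mathbb Z^{2g})=\{x\in\Lambda^k(\mathbb Z^{2g})\mid\omega^{g-k+1}\wedge x=0\}$. For an abelian group $A$ and integer $n$, $A/n$ means $A/nA$. A filtration $0=F_{-1}A\subset F_0A\subset\cdots\subset F_nA=A$ of a $\mathbb Z[G]$-module by $\mathbb Z[G]$-submodules is $\mathbb Z$-split if each short exact sequence $0\to F_{r-1}A\to F_rA\to\mathrm{gr}_rA\to 0$ splits as a sequence of abelian groups (not necessarily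 $G$-equivariantly). *)

theory Defs
  imports
    "HOL-Algebra.Free_Abelian_Groups"
    "HOL-Algebra.Elementary_Groups"
    "Jordan_Normal_Form.Matrix"
begin

section \<open>The exterior algebra of a free abelian group\<close>

text \<open>
  Abelian groups are written as in HOL-Algebra's \<open>free_Abelian_group\<close>: the operation \<open>mult\<close> is
  addition.  The basis vector \<open>e^m\<close> of \<open>Z^(2g)\<close> has index \<open>m - 1 \<in> {..<2 * g}\<close>.  The exterior
  algebra is the free abelian group on the monomials \<open>e_I = e_i1 \<and> \<dots> \<and> e_ik\<close>, where
  \<open>I = {i1 < \<dots> < ik}\<close>; such a monomial is represented by \<open>frag_of I\<close>.
\<close>

type_synonym ext = "nat set \<Rightarrow>\<^sub>0 int"

text \<open>The sign counts the transpositions that sort the concatenation of \<open>I\<close> and \<open>J\<close>.\<close>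

definition wedge_monom :: "nat set \<Rightarrow> nat set \<Rightarrow> ext" where
  "wedge_monom I J =
     (if I \<inter> J = {} then frag_cmul ((-1) ^ card {(a, b). a \<in> I \<and> b \<in> J \<and> b < a}) (frag_of (I \<union> J))
      else 0)"

definition wedge :: "ext \<Rightarrow> ext \<Rightarrow> ext" (infixr "\<^bold>\<and>" 70) where
  "x \<^bold>\<and> y = frag_extend (\<lambda>I. frag_extend (\<lambda>J. wedge_monom I J) y) x"

fun wedge_pow :: "ext \<Rightarrow> nat \<Rightarrow> ext" where
  "wedge_pow x 0 = frag_of {}"
| "wedge_pow x (Suc n) = x \<^bold>\<and> wedge_pow x n"

definition omega :: "nat \<Rightarrow> ext" where
  "omega g = (\<Sum>j<g. frag_of {2 * j} \<^bold>\<and> frag_of {2 * j + 1})"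

text \<open>The integral form \<open>\<omega>^i / i!\<close>; it exists and is unique by \<open>omega_div\<close> below.\<close>

definition omega_div_pow :: "nat \<Rightarrow> nat \<Rightarrow> ext" where
  "omega_div_pow g i = (THE x. frag_cmul (fact i) x = wedge_pow (omega g) i)"


section \<open>Modules over a group\<close>

text \<open>
  An abelian group with operators from a type \<open>'s\<close>.  The operators that matter are those in the
  group \<open>S\<close> passed to the definitions below.
\<close>

record ('a, 's) gmod = "'a monoid" +
  act :: "'s \<Rightarrow> 'a \<Rightarrow> 'a"

definition sub_gmod :: "('a, 's) gmod \<Rightarrow> 'a set \<Rightarrow> ('a, 's) gmod" where
  "sub_gmod M N = M\<lparr>carrier := N\<rparr>"

text \<open>An operator sends a coset, which is a set of elements, to its image.\<close>

definition quot_gmod :: "('a, 's) gmod \<Rightarrow> 'a set \<Rightarrow> ('a set, 's) gmod" where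
  "quot_gmod M N = monoid.extend (M Mod N) (gmod.fields (\<lambda>s C. act M s ` C))"

text \<open>The quotient \<open>A/n = A/nA\<close>; \<open>[^]\<close> is the multiple in additive notation.\<close>

definition mod_gmod :: "('a, 's) gmod \<Rightarrow> nat \<Rightarrow> ('a set, 's) gmod" where
  "mod_gmod M n = quot_gmod M ((\<lambda>x. x [^]\<^bsub>M\<^esub> n) ` carrier M)"

definition gmod_isomorphic :: "'s set \<Rightarrow> ('a, 's) gmod \<Rightarrow> ('b, 's) gmod \<Rightarrow> bool" where
  "gmod_isomorphic S M N \<longleftrightarrow>
     (\<exists>\<phi> \<in> iso M N. \<forall>s \<in> S. \<forall>x \<in> carrier M. \<phi> (act M s x) = act N s (\<phi> x))"

definition subgmod :: "'s set \<Rightarrow> 'a set \<Rightarrow> ('a, 's) gmod \<Rightarrow> bool" where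
  "subgmod S N M \<longleftrightarrow> subgroup N M \<and> (\<forall>s \<in> S. \<forall>x \<in> N. act M s x \<in> N)"

text \<open>
  A filtration \<open>0 = F_(-1) \<subseteq> F_0 \<subseteq> \<dots> \<subseteq> F_n = M\<close> is indexed by all integers, constant below \<open>-1\<close>
  and above \<open>n\<close>, so that \<open>gr_r\<close> makes sense (and vanishes) for the remaining \<open>r\<close>.  The inclusions
  need not be strict.
\<close>

definition gmod_filtration :: "'s set \<Rightarrow> ('a, 's) gmod \<Rightarrow> nat \<Rightarrow> (int \<Rightarrow> 'a set) \<Rightarrow> bool" where
  "gmod_filtration S M n F \<longleftrightarrow>
     (\<forall>r. subgmod S (F r) M) \<and>
     (\<forall>r. F (r - 1) \<subseteq> F r) \<and>
     (\<forall>r \<le> -1. F r = {\<one>\<^bsub>M\<^esub>}) \<and>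
     (\<forall>r \<ge> int n. F r = carrier M)"

definition gr :: "('a, 's) gmod \<Rightarrow> (int \<Rightarrow> 'a set) \<Rightarrow> int \<Rightarrow> ('a set, 's) gmod" where
  "gr M F r = quot_gmod (sub_gmod M (F r)) (F (r - 1))"

text \<open>A section of the projection \<open>F_r \<rightarrow> gr_r\<close> is required to be additive, not equivariant.\<close>

definition Z_split :: "('a, 's) gmod \<Rightarrow> (int \<Rightarrow> 'a set) \<Rightarrow> bool" where
  "Z_split M F \<longleftrightarrow>
     (\<forall>r. \<exists>\<sigma> \<in> hom (gr M F r) (sub_gmod M (F r)).
        \<forall>C \<in> carrier (gr M F r). F (r - 1) #>\<^bsub>sub_gmod M (F r)\<^esub> \<sigma> C = C)"


section \<open>The symplectic group and its modules\<close>

definition symp_form :: "nat \<Rightarrow> int mat" where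
  "symp_form g = mat (2 * g) (2 * g)
     (\<lambda>(a, b). if even a \<and> b = a + 1 then 1 else if odd a \<and> a = b + 1 then -1 else 0)"

definition Sp :: "nat \<Rightarrow> int mat set" where
  "Sp g = {A \<in> carrier_mat (2 * g) (2 * g). transpose_mat A * symp_form g * A = symp_form g}"

text \<open>\<open>A\<close> acts by \<open>e_i1 \<and> \<dots> \<and> e_ik \<mapsto> A e_i1 \<and> \<dots> \<and> A e_ik\<close>.\<close>

definition mat_col_ext :: "int mat \<Rightarrow> nat \<Rightarrow> ext" where
  "mat_col_ext A j = (\<Sum>a<dim_row A. frag_cmul (A $$ (a, j)) (frag_of {a}))"

definition ext_act :: "int mat \<Rightarrow> ext \<Rightarrow> ext" where
  "ext_act A =
     frag_extend (\<lambda>I. foldr (\<lambda>j y. mat_col_ext A j \<^bold>\<and> y) (sorted_list_of_set I) (frag_of {}))"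

definition ext_power :: "nat \<Rightarrow> nat \<Rightarrow> (ext, int mat) gmod" where
  "ext_power g k =
     monoid.extend (free_Abelian_group {I. I \<subseteq> {..<2 * g} \<and> card I = k}) (gmod.fields ext_act)"

text \<open>Only used for \<open>k \<le> g\<close>.\<close>

definition primitive :: "nat \<Rightarrow> nat \<Rightarrow> (ext, int mat) gmod" where
  "primitive g k = sub_gmod (ext_power g k)
     {x \<in> carrier (ext_power g k). wedge_pow (omega g) (g - k + 1) \<^bold>\<and> x = 0}"

definition coker_omega :: "nat \<Rightarrow> nat \<Rightarrow> (ext set, int mat) gmod" where
  "coker_omega g i = quot_gmod (ext_power g (g + i))
     ((\<lambda>x. x \<^bold>\<and> omega_div_pow g i) ` carrier (ext_power g (g - i)))"


section \<open>Integrality of the divided powers\<close>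

definition pair_union :: "nat set \<Rightarrow> nat set" where
  "pair_union S = (\<Union>j\<in>S. {2 * j, 2 * j + 1})"

lemma pair_mem [simp]:
  "2 * j \<in> pair_union S \<longleftrightarrow> j \<in> S" "Suc (2 * j) \<in> pair_union S \<longleftrightarrow> j \<in> S"
  by (auto simp: pair_union_def) presburger+

lemma wedge_frag_of [simp]: "frag_of I \<^bold>\<and> frag_of J = wedge_monom I J"
  by (simp add: wedge_def)

lemma wedge_sum_left: "finite T \<Longrightarrow> (\<Sum>t\<in>T. f t) \<^bold>\<and> y = (\<Sum>t\<in>T. f t \<^bold>\<and> y)"
  by (simp add: wedge_def frag_extend_sum o_def)

lemma wedge_sum_right: "finite T \<Longrightarrow> frag_of I \<^bold>\<and> (\<Sum>t\<in>T. f t) = (\<Sum>t\<in>T. frag_of I \<^bold>\<and> f t)"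
  by (simp add: wedge_def frag_extend_sum o_def)

lemma wedge_cmul_right: "x \<^bold>\<and> frag_cmul c y = frag_cmul c (x \<^bold>\<and> y)"
  unfolding wedge_def frag_extend_cmul
  by (simp add: frag_extend_def frag_cmul_sum mult.left_commute)

lemma omega_eq: "omega g = (\<Sum>j<g. frag_of {2 * j, 2 * j + 1})"
proof -
  have "wedge_monom {2 * j} {2 * j + 1} = frag_of {2 * j, 2 * j + 1}" for j
  proof -
    have no_inv: "{(a, b). a \<in> {2 * j} \<and> b \<in> {2 * j + 1} \<and> b < a} = {}" by auto
    show ?thesis unfolding wedge_monom_def no_inv by (simp add: insert_commute)
  qed
  then show ?thesis by (simp add: omega_def)
qed

lemma wedge_pair:
  assumes "finite S"
  shows "wedge_monom {2 * j, 2 * j + 1} (pair_union S) =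
    (if j \<in> S then 0 else frag_of (pair_union (insert j S)))"
proof (cases "j \<in> S")
  case False
  have eq: "{(a, b). a \<in> {2 * j, 2 * j + 1} \<and> b \<in> pair_union S \<and> b < a} =
      {2 * j, 2 * j + 1} \<times> {b \<in> pair_union S. b < 2 * j}"
    using False by (auto simp: less_Suc_eq)
  have "card {(a, b). a \<in> {2 * j, 2 * j + 1} \<and> b \<in> pair_union S \<and> b < a} =
      2 * card {b \<in> pair_union S. b < 2 * j}"
    unfolding eq by (simp add: card_cartesian_product)
  moreover have "{2 * j, 2 * j + 1} \<inter> pair_union S = {}" using False by auto
  moreover have "{2 * j, 2 * j + 1} \<union> pair_union S = pair_union (insert j S)"
    by (simp add: pair_union_def)
  ultimately show ?thesis using False by (simp add: wedge_monom_def)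
qed (auto simp: wedge_monom_def)

definition omega_gamma :: "nat \<Rightarrow> nat \<Rightarrow> ext" where
  "omega_gamma g i = (\<Sum>S | S \<subseteq> {..<g} \<and> card S = i. frag_of (pair_union S))"

lemma finite_subs [simp]: "finite {S. S \<subseteq> {..<g::nat} \<and> P S}"
  by (rule finite_subset[of _ "Pow {..<g}"]) auto

lemma omega_wedge_gamma:
  "omega g \<^bold>\<and> omega_gamma g i = frag_cmul (int (Suc i)) (omega_gamma g (Suc i))"
proof -
  let ?K = "\<lambda>i. {S. S \<subseteq> {..<g} \<and> card S = i}"
  have "omega g \<^bold>\<and> omega_gamma g i =
      (\<Sum>j<g. \<Sum>S\<in>?K i. wedge_monom {2 * j, 2 * j + 1} (pair_union S))"
    by (simp add: omega_eq omega_gamma_def wedge_sum_left wedge_sum_right)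
  also have "\<dots> = (\<Sum>j<g. \<Sum>S\<in>?K i. if j \<in> S then 0 else frag_of (pair_union (insert j S)))"
    by (intro sum.cong refl wedge_pair) (auto intro: finite_subset)
  also have "\<dots> = (\<Sum>(j, S) \<in> {..<g} \<times> ?K i. if j \<in> S then 0 else frag_of (pair_union (insert j S)))"
    by (simp add: sum.cartesian_product)
  also have "\<dots> = (\<Sum>(j, S) \<in> {(j, S). j < g \<and> S \<in> ?K i \<and> j \<notin> S}. frag_of (pair_union (insert j S)))"
    by (rule sum.mono_neutral_cong_right) auto
  also have "\<dots> = (\<Sum>(T, j) \<in> (SIGMA T:?K (Suc i). T). frag_of (pair_union T))"
    by (rule sum.reindex_bij_witness[where i = "\<lambda>(T, j). (j, T - {j})" and j = "\<lambda>(j, S). (insert j S, j)"])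
       (auto simp: insert_absorb finite_subset[OF _ finite_lessThan])
  also have "\<dots> = (\<Sum>T\<in>?K (Suc i). \<Sum>j\<in>T. frag_of (pair_union T))"
    by (rule sum.Sigma[symmetric]) (auto intro: finite_subset)
  also have "\<dots> = (\<Sum>T\<in>?K (Suc i). frag_cmul (int (Suc i)) (frag_of (pair_union T)))"
  proof (intro sum.cong refl)
    fix T assume T: "T \<in> ?K (Suc i)"
    have const: "(\<Sum>j\<in>U. x) = frag_cmul (int (card U)) x" if "finite U" for U :: "nat set" and x :: ext
      using that by induction (simp_all add: frag_cmul_distrib)
    have "finite T" "card T = Suc i" using T by (auto intro: finite_subset)
    then show "(\<Sum>j\<in>T. frag_of (pair_union T)) = frag_cmul (int (Suc i)) (frag_of (pair_union T))"
      using const[of T "frag_of (pair_union T)"] by simp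
  qed
  finally show ?thesis by (simp only: omega_gamma_def frag_cmul_sum)
qed

lemma wedge_pow_omega: "wedge_pow (omega g) i = frag_cmul (fact i) (omega_gamma g i)"
proof (induction i)
  case 0
  have "{S. S \<subseteq> {..<g} \<and> card S = 0} = {{}}" by (auto dest: finite_subset)
  then show ?case by (simp add: omega_gamma_def pair_union_def)
next
  case (Suc i)
  then show ?case by (simp add: wedge_cmul_right omega_wedge_gamma algebra_simps)
qed

lemma frag_cmul_cancel: "c \<noteq> 0 \<Longrightarrow> frag_cmul c x = frag_cmul c y \<longleftrightarrow> x = y"
  by (metis lookup_frag_cmul mult_left_cancel poly_mapping_eqI)

lemma omega_div_pow_eq: "omega_div_pow g i = omega_gamma g i"
  unfolding omega_div_pow_def by (rule the_equality) (simp_all add: wedge_pow_omega frag_cmul_cancel)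

lemma omega_div: "\<exists>!x. frag_cmul (fact i) x = wedge_pow (omega g) i"
  by (auto simp: wedge_pow_omega frag_cmul_cancel)

end

theory Submission
  imports Defs "Jordan_Normal_Form.Determinant"
begin

text \<open>
  Write \<open>L\<close> for multiplication by \<open>\<omega>\<close> and \<open>L\<^sub>s\<close> for multiplication by \<open>\<omega>\<^sup>s / s!\<close>, so that
  \<open>L\<^sub>s L\<^sub>t = (s + t choose s) L\<^sub>s\<^sub>+\<^sub>t\<close>.  The cokernel is filtered by the images of the kernels of
  \<open>L\<^sub>r\<^sub>+\<^sub>1\<close> on the forms of degree \<open>g + i\<close>.  Splitting off one symplectic pair at a time shows that
  \<open>L\<^sub>s\<close> is injective in degrees at most \<open>g - s\<close>, and that every \<open>q\<close> of degree \<open>g + j\<close> with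
  \<open>L q = 0\<close> is of the form \<open>L\<^sub>s y\<close> for each \<open>s \<le> j\<close>.  For \<open>j = i + 2 r\<close> let \<open>Q\<close> be the group of
  these \<open>q\<close>.  Then \<open>L\<^sub>r\<close> identifies \<open>gr\<^sub>r\<close> with \<open>Q / (r + i choose i)\<close>, because
  \<open>L\<^sub>r L\<^sub>i = (r + i choose i) L\<^sub>r\<^sub>+\<^sub>i\<close>, and \<open>L\<^sub>j\<close> identifies the primitive forms of degree \<open>g - j\<close>
  with \<open>Q\<close>.  A splitting amounts to lifting \<open>q\<close> along \<open>L\<^sub>r\<close> to a form \<open>x\<close> for which
  \<open>(r + i choose i) x\<close> is in the image of \<open>L\<^sub>i\<close>.  With \<open>L\<^sub>j\<^sub>-\<^sub>s y\<^sub>s = q\<close>, such an \<open>x\<close> is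
  \<open>\<Sum>s\<le>r. (-1)\<^sup>s (r choose s) L\<^sub>i\<^sub>+\<^sub>r\<^sub>-\<^sub>s y\<^sub>s\<close>.
\<close>

section \<open>Wedge products and divided powers of \<open>\<omega>\<close>\<close>

lemma additive_frag_extend: "additive (frag_extend f)"
  by (simp add: additive_def frag_extend_add)

text \<open>Integer multiples are iterated sums, so additivity already gives linearity. The
  operators below can thus be treated through the locale \<open>additive\<close>, without a module
  structure.\<close>

lemma additive_frag_cmul:
  assumes "additive (f :: ('a \<Rightarrow>\<^sub>0 int) \<Rightarrow> ('b \<Rightarrow>\<^sub>0 int))"
  shows "f (frag_cmul c x) = frag_cmul c (f x)"
proof -
  interpret additive f by fact
  have nat: "f (frag_cmul (int n) x) = frag_cmul (int n) (f x)" for n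
    by (induction n) (simp_all add: zero add frag_cmul_distrib)
  show ?thesis
  proof (cases c rule: int_cases2)
    case (nonpos n)
    then have "f (frag_cmul c x) = f (- frag_cmul (int n) x)" by simp
    then show ?thesis using nonpos by (simp only: minus nat) simp
  qed (simp add: nat)
qed

text \<open>Extension by linearity: \<open>frag_induction\<close> builds \<open>x\<close> from
  monomials in \<open>S\<close> by taking differences. Identities between operators are checked on
  monomials in this way.\<close>

lemma additive_eqI:
  assumes "additive f" "additive h" "Poly_Mapping.keys x \<subseteq> S" "\<And>I. I \<in> S \<Longrightarrow> f (frag_of I) = h (frag_of I)"
  shows "f x = h x"
proof -
  interpret f: additive f by fact
  interpret h: additive h by fact
  show ?thesis using assms(3)
    by (induction x rule: frag_induction) (simp_all add: f.zero h.zero f.diff h.diff assms(4))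
qed

lemma additive_compose: "additive f \<Longrightarrow> additive h \<Longrightarrow> additive (\<lambda>x. f (h x))"
  by (simp add: additive_def)

lemma additive_wedge_left: "additive (\<lambda>x. x \<^bold>\<and> y)"
  by (simp add: additive_def wedge_def frag_extend_add)

lemma additive_wedge_right: "additive (\<lambda>y. x \<^bold>\<and> y)"
  by (simp add: additive_def wedge_def frag_extend_def[of _ x] frag_extend_add frag_cmul_distrib2 sum.distrib)

lemmas wedge_add_left = additive.add[OF additive_wedge_left]
  and wedge_add_right = additive.add[OF additive_wedge_right]
  and wedge_zero_left [simp] = additive.zero[OF additive_wedge_left]
  and wedge_zero_right [simp] = additive.zero[OF additive_wedge_right]
  and wedge_minus_left = additive.minus[OF additive_wedge_left]
  and wedge_sum_fun = additive.sum[OF additive_wedge_right]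
  and sum_fun_wedge = additive.sum[OF additive_wedge_left]
  and wedge_cmul_left = additive_frag_cmul[OF additive_wedge_left]

section \<open>Inversion counts and associativity of the wedge product\<close>

abbreviation invs :: "nat set \<Rightarrow> nat set \<Rightarrow> (nat \<times> nat) set" where
  "invs I J \<equiv> {(a, b). a \<in> I \<and> b \<in> J \<and> b < a}"

lemma finite_invs: "finite I \<Longrightarrow> finite (invs I J)"
  by (rule finite_subset[of _ "SIGMA a:I. {..<a}"]) auto

lemma card_invs_Un_left:
  assumes "finite I" "finite J" "I \<inter> J = {}"
  shows "card (invs (I \<union> J) K) = card (invs I K) + card (invs J K)"
proof -
  have "invs (I \<union> J) K = invs I K \<union> invs J K" by auto
  then show ?thesis
    using assms by (simp only: ) (intro card_Un_disjoint finite_invs; auto)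
qed

lemma card_invs_Un_right:
  assumes "finite I" "J \<inter> K = {}"
  shows "card (invs I (J \<union> K)) = card (invs I J) + card (invs I K)"
proof -
  have "invs I (J \<union> K) = invs I J \<union> invs I K" by auto
  then show ?thesis
    using assms by (simp only: ) (intro card_Un_disjoint finite_invs; auto)
qed

text \<open>Inversions are additive in each argument over disjoint unions, so either bracketing
  collects \<open>invs I J\<close>, \<open>invs I K\<close> and \<open>invs J K\<close>. If two of
  the sets meet, both sides vanish.\<close>

lemma wedge_assoc_monom:
  assumes "finite I" "finite J"
  shows "(frag_of I \<^bold>\<and> frag_of J) \<^bold>\<and> frag_of K = frag_of I \<^bold>\<and> frag_of J \<^bold>\<and> frag_of K"
proof (cases "I \<inter> J = {} \<and> I \<inter> K = {} \<and> J \<inter> K = {}")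
  case True
  then show ?thesis
    using assms
    by (simp add: wedge_monom_def wedge_cmul_left wedge_cmul_right card_invs_Un_left card_invs_Un_right
        Int_Un_distrib Int_Un_distrib2 Un_assoc power_add mult_ac del: Un_iff)
next
  case False
  then show ?thesis
    by (auto simp add: wedge_monom_def wedge_cmul_left wedge_cmul_right Int_Un_distrib Int_Un_distrib2)
qed

text \<open>The type \<open>ext\<close> also contains monomials on infinite sets, where the set of
  inversions may be infinite and its \<open>card\<close> is then 0. Finiteness of the two left
  factors keeps every count finite.\<close>

lemma wedge_assoc:
  assumes "Poly_Mapping.keys x \<subseteq> Collect finite" "Poly_Mapping.keys y \<subseteq> Collect finite"
  shows "(x \<^bold>\<and> y) \<^bold>\<and> z = x \<^bold>\<and> y \<^bold>\<and> z"
proof -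
  note add = additive_wedge_left additive_wedge_right
    additive_compose[OF additive_wedge_left] additive_compose[OF additive_wedge_right]
  have 1: "(frag_of I \<^bold>\<and> frag_of J) \<^bold>\<and> z = frag_of I \<^bold>\<and> frag_of J \<^bold>\<and> z" if "finite I" "finite J" for I J
    by (rule additive_eqI[where x = z and S = UNIV]) (intro add wedge_assoc_monom that subset_UNIV)+
  have 2: "(frag_of I \<^bold>\<and> y) \<^bold>\<and> z = frag_of I \<^bold>\<and> y \<^bold>\<and> z" if "finite I" for I
    by (rule additive_eqI[where x = y, OF _ _ assms(2)])
       (use that in \<open>intro add 1; simp\<close>)+
  show ?thesis
    by (rule additive_eqI[where x = x, OF _ _ assms(1)])
       (intro add 2; simp)+
qed

section \<open>Signs of unions of symplectic pairs\<close>

lemma sum_pair_union: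
  assumes "finite S"
  shows "(\<Sum>a\<in>pair_union S. f a) = (\<Sum>j\<in>S. f (2 * j) + f (2 * j + 1))"
proof -
  have "(\<Sum>a\<in>pair_union S. f a) = (\<Sum>j\<in>S. \<Sum>a\<in>{2 * j, 2 * j + 1}. f a)"
    unfolding pair_union_def
    by (rule sum.UNION_disjoint) (use assms in auto)
  also have "\<dots> = (\<Sum>j\<in>S. f (2 * j) + f (2 * j + 1))"
    by (intro sum.cong) auto
  finally show ?thesis .
qed

lemma finite_pair_union: "finite S \<Longrightarrow> finite (pair_union S)"
  by (simp add: pair_union_def)

lemma card_pair_union: "finite S \<Longrightarrow> card (pair_union S) = 2 * card S"
  using sum_pair_union[of S "\<lambda>_. 1 :: nat"] by simp

text \<open>An element of \<open>I\<close> lies below both members of a disjoint pair or above both.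
  Hence the inversions over \<open>2 * j\<close> and over \<open>2 * j + 1\<close> are equal in
  number and the total is even.\<close>

lemma wedge_monom_pair_left:
  assumes "finite S" "pair_union S \<inter> I = {}"
  shows "wedge_monom (pair_union S) I = frag_of (pair_union S \<union> I)"
proof -
  have "2 * j \<notin> I" if "j \<in> S" for j using that assms(2) by (metis pair_mem(1) disjoint_iff)
  then have *: "{b \<in> I. b < Suc (2 * j)} = {b \<in> I. b < 2 * j}" if "j \<in> S" for j
    using that by (auto simp: less_Suc_eq)
  have "invs (pair_union S) I = (SIGMA a:pair_union S. {b \<in> I. b < a})" by auto
  then have "card (invs (pair_union S) I) = (\<Sum>a\<in>pair_union S. card {b \<in> I. b < a})"
    using assms(1) by (simp add: finite_pair_union)
  also have "even \<dots>"
    unfolding sum_pair_union[OF assms(1)] by (rule dvd_sum) (simp add: *)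
  finally show ?thesis using assms by (simp add: wedge_monom_def)
qed

text \<open>The same parity count, now over the elements of the second factor. Their fibres consist
  of larger elements of \<open>I\<close> and are finite because \<open>I\<close> is.\<close>

lemma wedge_monom_pair_right:
  assumes "finite S" "finite I" "pair_union S \<inter> I = {}"
  shows "wedge_monom I (pair_union S) = frag_of (pair_union S \<union> I)"
proof -
  have "Suc (2 * j) \<notin> I" if "j \<in> S" for j using that assms(3) by (metis pair_mem(2) disjoint_iff)
  then have *: "{a \<in> I. Suc (2 * j) < a} = {a \<in> I. 2 * j < a}" if "j \<in> S" for j
    using that by (metis Suc_lessI Suc_lessD)
  have "invs I (pair_union S) = prod.swap ` (SIGMA b:pair_union S. {a \<in> I. b < a})" by force
  then have "card (invs I (pair_union S)) = (\<Sum>b\<in>pair_union S. card {a \<in> I. b < a})"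
    using assms by (simp add: card_image finite_pair_union)
  also have "even \<dots>"
    unfolding sum_pair_union[OF assms(1)] by (rule dvd_sum) (simp add: *)
  finally show ?thesis using assms by (simp add: wedge_monom_def Int_commute Un_commute)
qed

text \<open>
  Multiplication by \<open>\<omega>\<^sup>s / s!\<close>, on either side.  No sign occurs: a pair \<open>{2 j, 2 j + 1}\<close> disjoint
  from \<open>I\<close> contributes an even number of inversions with \<open>I\<close>.
\<close>

definition div_pow :: "nat \<Rightarrow> nat \<Rightarrow> ext \<Rightarrow> ext" where
  "div_pow g s = frag_extend (\<lambda>I. \<Sum>S | S \<subseteq> {..<g} \<and> card S = s.
     if pair_union S \<inter> I = {} then frag_of (pair_union S \<union> I) else 0)"

lemma additive_div_pow: "additive (div_pow g s)"
  unfolding div_pow_def by (rule additive_frag_extend)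

lemmas div_pow_add = additive.add[OF additive_div_pow]
  and div_pow_zero [simp] = additive.zero[OF additive_div_pow]
  and div_pow_diff = additive.diff[OF additive_div_pow]
  and div_pow_minus = additive.minus[OF additive_div_pow]
  and div_pow_sum = additive.sum[OF additive_div_pow]
  and div_pow_cmul = additive_frag_cmul[OF additive_div_pow]

lemma wedge_gamma_left: "omega_gamma g s \<^bold>\<and> x = div_pow g s x"
proof (rule additive_eqI[where S = UNIV and x = x])
  fix I
  have "wedge_monom (pair_union S) I = (if pair_union S \<inter> I = {} then frag_of (pair_union S \<union> I) else 0)"
    if "S \<subseteq> {..<g}" for S
    using that finite_subset[OF that] by (simp add: wedge_monom_pair_left) (simp add: wedge_monom_def)
  then show "omega_gamma g s \<^bold>\<and> frag_of I = div_pow g s (frag_of I)"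
    by (simp add: omega_gamma_def sum_fun_wedge div_pow_def)
qed (rule additive_wedge_right additive_div_pow subset_UNIV)+

lemma wedge_gamma_right:
  assumes "Poly_Mapping.keys x \<subseteq> Collect finite"
  shows "x \<^bold>\<and> omega_gamma g s = div_pow g s x"
proof (rule additive_eqI[where x = x, OF _ _ assms])
  fix I :: "nat set" assume "I \<in> Collect finite"
  then have "wedge_monom I (pair_union S) = (if pair_union S \<inter> I = {} then frag_of (pair_union S \<union> I) else 0)"
    if "S \<subseteq> {..<g}" for S
    using that finite_subset[OF that]
    by (simp add: wedge_monom_pair_right) (simp add: wedge_monom_def Int_commute)
  then show "frag_of I \<^bold>\<and> omega_gamma g s = div_pow g s (frag_of I)"
    by (simp add: omega_gamma_def wedge_sum_fun div_pow_def)
qed (rule additive_wedge_left additive_div_pow)+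

lemma keys_omega_gamma: "Poly_Mapping.keys (omega_gamma g s) \<subseteq> Collect finite"
proof -
  have "Poly_Mapping.keys (omega_gamma g s) \<subseteq>
      (\<Union>S\<in>{S. S \<subseteq> {..<g} \<and> card S = s}. Poly_Mapping.keys (frag_of (pair_union S)))"
    unfolding omega_gamma_def by (rule keys_sum)
  also have "\<dots> \<subseteq> Collect finite"
    by (auto intro!: finite_pair_union finite_subset[of _ "{..<g}"])
  finally show ?thesis .
qed

lemma omega_eq_gamma: "omega g = omega_gamma g 1"
proof -
  have "omega_gamma g 0 = frag_of {}"
    using wedge_pow_omega[of g 0] by simp
  moreover have "omega g \<^bold>\<and> frag_of {} = omega g"
    by (simp add: omega_eq sum_fun_wedge wedge_monom_def)
  ultimately show ?thesis
    using omega_wedge_gamma[of g 0] by simp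
qed

lemma div_pow_0 [simp]: "div_pow g 0 x = x"
proof -
  have "omega_gamma g 0 = frag_of {}"
    using wedge_pow_omega[of g 0] by simp
  moreover have "frag_of {} \<^bold>\<and> x = x"
    by (rule additive_eqI[where S = UNIV and h = "\<lambda>x. x"])
       (auto simp: wedge_monom_def additive_def wedge_add_right)
  ultimately show ?thesis by (metis wedge_gamma_left)
qed

text \<open>Associativity carries \<open>omega_wedge_gamma\<close> over to operators. Relations
  among the divided powers are derived from this recursion by cancelling \<open>Suc s\<close>, the
  group of forms being torsion-free.\<close>

lemma div_pow_Suc: "div_pow g 1 (div_pow g s x) = frag_cmul (int (Suc s)) (div_pow g (Suc s) x)"
proof -
  have "div_pow g 1 (div_pow g s x) = omega g \<^bold>\<and> omega_gamma g s \<^bold>\<and> x"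
    by (simp add: wedge_gamma_left omega_eq_gamma)
  also have "\<dots> = (omega g \<^bold>\<and> omega_gamma g s) \<^bold>\<and> x"
    using keys_omega_gamma by (simp add: wedge_assoc omega_eq_gamma)
  also have "\<dots> = frag_cmul (int (Suc s)) (div_pow g (Suc s) x)"
    by (simp only: omega_wedge_gamma wedge_cmul_left wedge_gamma_left)
  finally show ?thesis .
qed

lemma wedge_pow_wedge: "wedge_pow (omega g) s \<^bold>\<and> x = frag_cmul (fact s) (div_pow g s x)"
  by (simp add: wedge_pow_omega wedge_cmul_left wedge_gamma_left)

text \<open>Induction on \<open>s\<close>: after multiplication by \<open>Suc s\<close> both sides
  unfold by \<open>div_pow_Suc\<close>, and the absorption identity for binomial coefficients
  matches the factors. Then \<open>Suc s\<close> is cancelled.\<close>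

lemma div_pow_mult: "div_pow g s (div_pow g t x) = frag_cmul (int ((s + t) choose s)) (div_pow g (s + t) x)"
proof (induction s)
  case (Suc s)
  have "frag_cmul (int (Suc s)) (div_pow g (Suc s) (div_pow g t x)) =
      frag_cmul (int ((s + t) choose s) * int (Suc (s + t))) (div_pow g (Suc (s + t)) x)"
    by (simp only: div_pow_Suc[symmetric] Suc div_pow_cmul) (simp only: div_pow_Suc frag_cmul_cmul)
  also have "int ((s + t) choose s) * int (Suc (s + t)) = int (Suc s) * int ((Suc s + t) choose Suc s)"
    using Suc_times_binomial_eq[of "s + t" s] by (metis add_Suc mult.commute of_nat_mult)
  finally show ?case
    by (simp only: frag_cmul_cmul[symmetric]) (simp add: frag_cmul_cancel del: frag_cmul_cmul of_nat_Suc)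
qed simp

text \<open>A positive binomial multiple of \<open>L\<^sub>t\<close> factors through
  \<open>L\<^sub>s\<close>, and there is no torsion.\<close>

lemma div_pow_eq_0_mono:
  assumes "div_pow g s x = 0" "s \<le> t"
  shows "div_pow g t x = 0"
proof -
  have "frag_cmul (int ((t - s + s) choose (t - s))) (div_pow g (t - s + s) x) = 0"
    by (simp only: div_pow_mult[symmetric] assms) simp
  then show ?thesis using assms(2) by auto
qed

text \<open>Degrees are integers because removing a symplectic pair lowers them by up to 2; a
  negative degree then names the zero group.\<close>

definition ext_deg :: "nat \<Rightarrow> int \<Rightarrow> ext set" where
  "ext_deg g d = {x. Poly_Mapping.keys x \<subseteq> {I. I \<subseteq> {..<2 * g} \<and> int (card I) = d}}"

lemma ext_deg_0 [simp]: "0 \<in> ext_deg g d"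
  by (simp add: ext_deg_def)

lemma ext_deg_add: "x \<in> ext_deg g d \<Longrightarrow> y \<in> ext_deg g d \<Longrightarrow> x + y \<in> ext_deg g d"
  using keys_add[of x y] unfolding ext_deg_def by blast

lemma ext_deg_diff: "x \<in> ext_deg g d \<Longrightarrow> y \<in> ext_deg g d \<Longrightarrow> x - y \<in> ext_deg g d"
  using keys_diff[of x y] unfolding ext_deg_def by blast

lemma ext_deg_minus: "x \<in> ext_deg g d \<Longrightarrow> - x \<in> ext_deg g d"
  by (simp add: ext_deg_def)

lemma ext_deg_cmul: "x \<in> ext_deg g d \<Longrightarrow> frag_cmul c x \<in> ext_deg g d"
  using keys_cmul unfolding ext_deg_def by blast

lemma ext_deg_sum: "(\<And>i. i \<in> A \<Longrightarrow> f i \<in> ext_deg g d) \<Longrightarrow> sum f A \<in> ext_deg g d"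
  by (induction A rule: infinite_finite_induct) (auto intro: ext_deg_add)

lemma ext_deg_frag_of: "frag_of I \<in> ext_deg g d \<longleftrightarrow> I \<subseteq> {..<2 * g} \<and> int (card I) = d"
  by (simp add: ext_deg_def)

lemma ext_deg_finite: "x \<in> ext_deg g d \<Longrightarrow> Poly_Mapping.keys x \<subseteq> Collect finite"
  unfolding ext_deg_def by (blast intro: finite_subset[OF _ finite_lessThan])

lemma ext_deg_empty: "x \<in> ext_deg g d \<Longrightarrow> d < 0 \<or> d > 2 * int g \<Longrightarrow> x = 0"
proof -
  assume x: "x \<in> ext_deg g d" and d: "d < 0 \<or> d > 2 * int g"
  have "\<not> (I \<subseteq> {..<2 * g} \<and> int (card I) = d)" for I
  proof
    assume I: "I \<subseteq> {..<2 * g} \<and> int (card I) = d"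
    then have "card I \<le> 2 * g" using card_mono[of "{..<2 * g}" I] by simp
    then show False using I d by linarith
  qed
  then have "{I. I \<subseteq> {..<2 * g} \<and> int (card I) = d} = {}" by blast
  then show "x = 0" using x unfolding ext_deg_def by (simp only: subset_empty keys_eq_empty mem_Collect_eq)
qed

lemma additive_ext_deg:
  assumes "additive f" "x \<in> ext_deg g d"
    and "\<And>I. I \<subseteq> {..<2 * g} \<Longrightarrow> int (card I) = d \<Longrightarrow> f (frag_of I) \<in> ext_deg h e"
  shows "f x \<in> ext_deg h e"
proof -
  interpret additive f by fact
  have "Poly_Mapping.keys x \<subseteq> {I. I \<subseteq> {..<2 * g} \<and> int (card I) = d}"
    using assms(2) by (simp add: ext_deg_def)
  then show ?thesis
    by (induction x rule: frag_induction) (simp_all add: zero diff assms(3) ext_deg_diff)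
qed

lemma pair_union_subset: "S \<subseteq> {..<g} \<Longrightarrow> pair_union S \<subseteq> {..<2 * g}"
  by (fastforce simp: pair_union_def)

lemma div_pow_ext_deg:
  assumes "x \<in> ext_deg g d" "e = d + 2 * int s"
  shows "div_pow g s x \<in> ext_deg g e"
proof (rule additive_ext_deg[OF additive_div_pow assms(1)])
  fix I assume I: "I \<subseteq> {..<2 * g}" "int (card I) = d"
  have fin: "finite I" using I(1) finite_subset by blast
  have mem: "frag_of (pair_union S \<union> I) \<in> ext_deg g e"
    if S: "S \<subseteq> {..<g}" "card S = s" and disj: "pair_union S \<inter> I = {}" for S
  proof -
    have "finite S" using S(1) finite_subset by blast
    then have "card (pair_union S \<union> I) = 2 * card S + card I"
      using disj fin by (simp add: card_Un_disjoint card_pair_union finite_pair_union)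
    then show ?thesis
      using I assms(2) S pair_union_subset[OF S(1)] by (simp add: ext_deg_frag_of)
  qed
  show "div_pow g s (frag_of I) \<in> ext_deg g e"
    unfolding div_pow_def frag_extend_of by (rule ext_deg_sum) (simp add: mem)
qed

section \<open>Splitting off a symplectic pair\<close>

text \<open>Only used when \<open>T\<close> is disjoint from the monomials of the argument; the sign of the wedge product is dropped.\<close>

definition ins :: "nat set \<Rightarrow> ext \<Rightarrow> ext" where
  "ins T = frag_extend (\<lambda>I. frag_of (T \<union> I))"

text \<open>Coefficient extraction: for \<open>T\<close> inside the new pair
  \<open>{2 * g, 2 * g + 1}\<close>, this keeps the monomials that meet the pair exactly in
  \<open>T\<close> and removes the pair from them. On forms of genus \<open>g\<close> it is a left
  inverse of \<open>ins T\<close>.\<close>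

definition proj :: "nat \<Rightarrow> nat set \<Rightarrow> ext \<Rightarrow> ext" where
  "proj g T = frag_extend (\<lambda>I. if I \<inter> {2 * g, 2 * g + 1} = T then frag_of (I - {2 * g, 2 * g + 1}) else 0)"

lemma additive_ins: "additive (ins T)"
  unfolding ins_def by (rule additive_frag_extend)

lemma additive_proj: "additive (proj g T)"
  unfolding proj_def by (rule additive_frag_extend)

lemmas ins_add = additive.add[OF additive_ins]
  and ins_zero [simp] = additive.zero[OF additive_ins]
  and ins_diff = additive.diff[OF additive_ins]
  and ins_sum = additive.sum[OF additive_ins]
  and proj_add = additive.add[OF additive_proj]
  and proj_zero [simp] = additive.zero[OF additive_proj]

lemma additive_sum_fun: "additive f \<Longrightarrow> additive h \<Longrightarrow> additive (\<lambda>x. f x + h x :: ext)"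
  by (simp add: additive_def)

lemma additive_eq_on_ext_deg:
  assumes "additive f" "additive h" "x \<in> ext_deg g d"
    and "\<And>I. I \<subseteq> {..<2 * g} \<Longrightarrow> int (card I) = d \<Longrightarrow> f (frag_of I) = h (frag_of I)"
  shows "f x = h x"
  by (rule additive_eqI[OF assms(1,2), where S = "{I. I \<subseteq> {..<2 * g} \<and> int (card I) = d}"])
    (use assms(3,4) in \<open>simp_all add: ext_deg_def\<close>)

lemma ins_frag_of: "ins T (frag_of I) = frag_of (T \<union> I)"
  by (simp add: ins_def)

lemma ins_empty [simp]: "ins {} x = x"
  by (rule additive_eqI[where x = x and S = UNIV, OF additive_ins])
     (simp_all add: additive_def ins_def)

lemma ins_ext_deg:
  assumes "x \<in> ext_deg g d" "T \<subseteq> {2 * g, 2 * g + 1}" "e = d + int (card T)"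
  shows "ins T x \<in> ext_deg (Suc g) e"
proof (rule additive_ext_deg[OF additive_ins assms(1)])
  fix I assume I: "I \<subseteq> {..<2 * g}" "int (card I) = d"
  then have "finite I" "finite T" using assms(2) by (auto intro: finite_subset)
  moreover have "x < 2 * g" if "x \<in> I" for x using I(1) that by auto
  then have "T \<inter> I = {}" using assms(2) by force
  ultimately have "card (T \<union> I) = card T + card I" by (simp add: card_Un_disjoint)
  moreover have "T \<union> I \<subseteq> {..<2 * Suc g}" using I(1) assms(2) by auto
  ultimately show "ins T (frag_of I) \<in> ext_deg (Suc g) e"
    using I(2) assms(3) by (simp add: ins_def ext_deg_frag_of)
qed

lemma ext_deg_Suc: "x \<in> ext_deg g d \<Longrightarrow> x \<in> ext_deg (Suc g) d"
  using ins_ext_deg[of x g d "{}" d] by simp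

lemma proj_ext_deg:
  assumes "x \<in> ext_deg (Suc g) d" "e = d - int (card T)"
  shows "proj g T x \<in> ext_deg g e"
proof (rule additive_ext_deg[OF additive_proj assms(1)])
  fix I assume I: "I \<subseteq> {..<2 * Suc g}" "int (card I) = d"
  show "proj g T (frag_of I) \<in> ext_deg g e"
  proof (cases "I \<inter> {2 * g, 2 * g + 1} = T")
    case True
    have fin: "finite I" using I(1) finite_subset by blast
    then have "card I = card (I - {2 * g, 2 * g + 1}) + card (I \<inter> {2 * g, 2 * g + 1})"
      by (subst card_Un_disjoint[symmetric]) (auto intro: arg_cong[where f = card])
    moreover have "I - {2 * g, 2 * g + 1} \<subseteq> {..<2 * g}" using I(1) by force
    ultimately show ?thesis using True I(2) assms(2) by (simp add: proj_def ext_deg_frag_of)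
  next
    case False
    then show ?thesis by (simp add: proj_def)
  qed
qed

lemma proj_ins:
  assumes "x \<in> ext_deg g d" "T' \<subseteq> {2 * g, 2 * g + 1}"
  shows "proj g T (ins T' x) = (if T = T' then x else 0)"
proof (rule additive_eq_on_ext_deg[OF additive_compose[OF additive_proj additive_ins] _ assms(1)])
  fix I assume "I \<subseteq> {..<2 * g}"
  then have "I \<inter> {2 * g, 2 * g + 1} = {}" by auto
  then have "(T' \<union> I) \<inter> {2 * g, 2 * g + 1} = T'" "(T' \<union> I) - {2 * g, 2 * g + 1} = I"
    using assms(2) by blast+
  then show "proj g T (ins T' (frag_of I)) = (if T = T' then frag_of I else 0)"
    by (simp add: proj_def ins_def)
qed (simp add: additive_def)

text \<open>The exterior algebra of genus \<open>Suc g\<close> as four copies of that of genus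
  \<open>g\<close>, indexed by the subsets of the new pair.\<close>

definition adjoin_pair :: "nat \<Rightarrow> ext \<Rightarrow> ext \<Rightarrow> ext \<Rightarrow> ext \<Rightarrow> ext" where
  "adjoin_pair g x0 x1 x2 x3 = x0 + ins {2 * g} x1 + ins {2 * g + 1} x2 + ins {2 * g, 2 * g + 1} x3"

lemma adjoin_pair_proj:
  assumes "x \<in> ext_deg (Suc g) d"
  shows "x = adjoin_pair g (proj g {} x) (proj g {2 * g} x) (proj g {2 * g + 1} x) (proj g {2 * g, 2 * g + 1} x)"
proof (rule additive_eq_on_ext_deg[OF _ _ assms, of "\<lambda>x. x"])
  show "additive (\<lambda>x. adjoin_pair g (proj g {} x) (proj g {2 * g} x) (proj g {2 * g + 1} x) (proj g {2 * g, 2 * g + 1} x))"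
    unfolding adjoin_pair_def
    by (intro additive_sum_fun additive_compose[OF additive_ins] additive_proj)
  fix I
  define T K where "T = I \<inter> {2 * g, 2 * g + 1}" and "K = I - {2 * g, 2 * g + 1}"
  have proj: "proj g T' (frag_of I) = (if T = T' then frag_of K else 0)" for T'
    by (simp only: proj_def frag_extend_of T_def K_def)
  have "T = {} \<or> T = {2 * g} \<or> T = {2 * g + 1} \<or> T = {2 * g, 2 * g + 1}"
    unfolding T_def by blast
  moreover have "I = T \<union> K" unfolding T_def K_def by blast
  ultimately show "frag_of I = adjoin_pair g (proj g {} (frag_of I)) (proj g {2 * g} (frag_of I))
      (proj g {2 * g + 1} (frag_of I)) (proj g {2 * g, 2 * g + 1} (frag_of I))"
    unfolding proj by (elim disjE) (simp_all add: adjoin_pair_def ins_frag_of doubleton_eq_iff)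
qed (simp add: additive_def)

text \<open>\<open>proj\<close> recovers each component; the degree hypotheses ensure that the
  components do not involve the new pair. Equations can therefore be read off componentwise.\<close>

lemma adjoin_pair_eq_0:
  assumes "adjoin_pair g x0 x1 x2 x3 = 0" "x0 \<in> ext_deg g d0" "x1 \<in> ext_deg g d1" "x2 \<in> ext_deg g d2" "x3 \<in> ext_deg g d3"
  shows "x0 = 0 \<and> x1 = 0 \<and> x2 = 0 \<and> x3 = 0"
proof -
  have "proj g T x0 = (if T = {} then x0 else 0)" for T
    using proj_ins[OF assms(2), of "{}" T] by simp
  then have "proj g T (adjoin_pair g x0 x1 x2 x3) = (if T = {} then x0 else if T = {2 * g} then x1
      else if T = {2 * g + 1} then x2 else if T = {2 * g, 2 * g + 1} then x3 else 0)" for T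
    using proj_ins[OF assms(3), of "{2 * g}" T] proj_ins[OF assms(4), of "{2 * g + 1}" T]
      proj_ins[OF assms(5), of "{2 * g, 2 * g + 1}" T]
    by (auto simp: adjoin_pair_def proj_add)
  note this[of "{}"] this[of "{2 * g}"] this[of "{2 * g + 1}"] this[of "{2 * g, 2 * g + 1}"]
  then show ?thesis using assms(1) by (simp add: doubleton_eq_iff)
qed

lemma adjoin_pair_ext_deg:
  assumes "x0 \<in> ext_deg g d" "x1 \<in> ext_deg g (d - 1)" "x2 \<in> ext_deg g (d - 1)" "x3 \<in> ext_deg g (d - 2)"
  shows "adjoin_pair g x0 x1 x2 x3 \<in> ext_deg (Suc g) d"
  unfolding adjoin_pair_def
  using ext_deg_Suc[OF assms(1)] ins_ext_deg[OF assms(2), of "{2 * g}" d] ins_ext_deg[OF assms(3), of "{2 * g + 1}" d]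
    ins_ext_deg[OF assms(4), of "{2 * g, 2 * g + 1}" d]
  by (simp add: ext_deg_add)

section \<open>Divided powers of \<open>\<omega>\<close> after adjoining a symplectic pair\<close>

lemma sum_subsets_Suc:
  fixes f :: "nat set \<Rightarrow> ext"
  shows "(\<Sum>S | S \<subseteq> {..<Suc g} \<and> card S = Suc s. f S) =
    (\<Sum>S | S \<subseteq> {..<g} \<and> card S = Suc s. f S) + (\<Sum>S | S \<subseteq> {..<g} \<and> card S = s. f (insert g S))"
proof -
  have "{S. S \<subseteq> {..<Suc g} \<and> card S = Suc s} =
      {S. S \<subseteq> {..<g} \<and> card S = Suc s} \<union> insert g ` {S. S \<subseteq> {..<g} \<and> card S = s}" (is "?A = ?B \<union> ?C")
  proof (intro equalityI subsetI)
    fix S assume S: "S \<in> ?A"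
    then have "finite S" using finite_subset by blast
    show "S \<in> ?B \<union> ?C"
    proof (cases "g \<in> S")
      case True
      then have "S = insert g (S - {g})" "S - {g} \<subseteq> {..<g}" "card (S - {g}) = s"
        using S \<open>finite S\<close> by (auto simp: less_Suc_eq)
      then show ?thesis by blast
    next
      case False
      then show ?thesis using S by (auto simp: less_Suc_eq lessThan_Suc)
    qed
  next
    fix S assume "S \<in> ?B \<union> ?C"
    then consider "S \<in> ?B" | S' where "S = insert g S'" "S' \<subseteq> {..<g}" "card S' = s" by blast
    then show "S \<in> ?A"
    proof cases
      case 2
      then have "finite S'" "g \<notin> S'" using finite_subset by blast+
      then show ?thesis using 2 by (auto simp: less_Suc_eq)
    qed (auto simp: less_Suc_eq)
  qed
  moreover have "inj_on (insert g) {S. S \<subseteq> {..<g} \<and> card S = s}"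
    by (rule inj_onI) (metis (no_types, lifting) insert_ident lessThan_iff less_irrefl mem_Collect_eq subsetD)
  moreover have "?B \<inter> ?C = {}" by auto
  ultimately show ?thesis
    by (simp add: sum.union_disjoint sum.reindex)
qed

lemma pair_union_insert: "pair_union (insert g S) = {2 * g, 2 * g + 1} \<union> pair_union S"
  by (simp add: pair_union_def)

text \<open>The new symplectic element is \<open>\<omega> + e\<close> with \<open>e\<close> the new
  pair and \<open>e \<and> e = 0\<close>. Its divided power of order \<open>Suc s\<close> is
  therefore the old one plus \<open>e\<close> times the old one of order \<open>s\<close>; the extra
  term kills monomials that already meet the pair.\<close>

lemma div_pow_Suc_ins:
  assumes "x \<in> ext_deg g d" "T \<subseteq> {2 * g, 2 * g + 1}"
  shows "div_pow (Suc g) (Suc s) (ins T x) =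
    ins T (div_pow g (Suc s) x) + (if T = {} then ins {2 * g, 2 * g + 1} (div_pow g s x) else 0)"
proof (rule additive_eq_on_ext_deg[OF _ _ assms(1)])
  show "additive (\<lambda>x. div_pow (Suc g) (Suc s) (ins T x))"
    by (intro additive_compose[OF additive_div_pow] additive_ins)
  show "additive (\<lambda>x. ins T (div_pow g (Suc s) x) +
      (if T = {} then ins {2 * g, 2 * g + 1} (div_pow g s x) else 0))"
    by (simp add: additive_def div_pow_add ins_add)
  fix I assume I: "I \<subseteq> {..<2 * g}"
  have low: "pair_union S \<inter> {2 * g, 2 * g + 1} = {}" if "S \<subseteq> {..<g}" for S
    using that by auto
  have "I \<inter> {2 * g, 2 * g + 1} = {}" using I by auto
  then have old: "pair_union S \<inter> (T \<union> I) = pair_union S \<inter> I"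
    and new: "pair_union (insert g S) \<inter> (T \<union> I) = {} \<longleftrightarrow> T = {} \<and> pair_union S \<inter> I = {}"
    if "S \<subseteq> {..<g}" for S
    using low[OF that] assms(2) unfolding pair_union_insert by blast+
  let ?D = "\<lambda>S. if pair_union S \<inter> (T \<union> I) = {} then frag_of (pair_union S \<union> (T \<union> I)) else 0"
  have "(\<Sum>S | S \<subseteq> {..<g} \<and> card S = Suc s. ?D S) = ins T (div_pow g (Suc s) (frag_of I))"
    unfolding div_pow_def frag_extend_of ins_sum
    by (rule sum.cong) (simp_all add: old ins_frag_of Un_left_commute)
  moreover have "(\<Sum>S | S \<subseteq> {..<g} \<and> card S = s. ?D (insert g S)) =
      (if T = {} then ins {2 * g, 2 * g + 1} (div_pow g s (frag_of I)) else 0)"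
  proof (cases "T = {}")
    case True
    have "(\<Sum>S | S \<subseteq> {..<g} \<and> card S = s. ?D (insert g S)) = ins {2 * g, 2 * g + 1} (div_pow g s (frag_of I))"
      unfolding div_pow_def frag_extend_of ins_sum
      by (rule sum.cong[OF refl]) (simp only: new mem_Collect_eq, simp add: True ins_frag_of pair_union_insert)
    then show ?thesis using True by simp
  next
    case False
    have "(\<Sum>S | S \<subseteq> {..<g} \<and> card S = s. ?D (insert g S)) = 0"
      by (rule sum.neutral) (use False in \<open>simp add: new\<close>)
    then show ?thesis using False by simp
  qed
  ultimately show "div_pow (Suc g) (Suc s) (ins T (frag_of I)) =
      ins T (div_pow g (Suc s) (frag_of I)) +
      (if T = {} then ins {2 * g, 2 * g + 1} (div_pow g s (frag_of I)) else 0)"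
    by (simp only: ins_frag_of div_pow_def frag_extend_of sum_subsets_Suc)
qed

text \<open>The operator is triangular: only \<open>x0\<close> feeds into another component. Both
  inductions on the genus below rest on this shape.\<close>

lemma div_pow_adjoin_pair:
  assumes "x0 \<in> ext_deg g d0" "x1 \<in> ext_deg g d1" "x2 \<in> ext_deg g d2" "x3 \<in> ext_deg g d3"
  shows "div_pow (Suc g) (Suc s) (adjoin_pair g x0 x1 x2 x3) =
    adjoin_pair g (div_pow g (Suc s) x0) (div_pow g (Suc s) x1) (div_pow g (Suc s) x2)
      (div_pow g (Suc s) x3 + div_pow g s x0)"
  using div_pow_Suc_ins[OF assms(1), of "{}" s] div_pow_Suc_ins[OF assms(2), of "{2 * g}" s]
    div_pow_Suc_ins[OF assms(3), of "{2 * g + 1}" s] div_pow_Suc_ins[OF assms(4), of "{2 * g, 2 * g + 1}" s]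
  by (simp add: adjoin_pair_def div_pow_add ins_add add_ac)

text \<open>Induction on the genus. The components \<open>x1\<close> and \<open>x2\<close> fall
  under the induction hypothesis directly. The top component couples \<open>x0\<close> with
  \<open>x3\<close>, and one further application of \<open>L\<close> separates them.\<close>

lemma div_pow_injective:
  assumes "x \<in> ext_deg g d" "d + int s \<le> int g" "div_pow g s x = 0"
  shows "x = 0"
  using assms
proof (induction g arbitrary: x d s)
  case 0
  then show ?case
    using ext_deg_empty[OF "0.prems"(1)] by (cases s) auto
next
  case (Suc g)
  show ?case
  proof (cases s)
    case 0
    then show ?thesis using Suc.prems by simp
  next
    case (Suc t)
    define x0 x1 x2 x3 where "x0 = proj g {} x" and "x1 = proj g {2 * g} x"
      and "x2 = proj g {2 * g + 1} x" and "x3 = proj g {2 * g, 2 * g + 1} x"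
    have x: "x = adjoin_pair g x0 x1 x2 x3"
      unfolding x0_def x1_def x2_def x3_def by (rule adjoin_pair_proj[OF Suc.prems(1)])
    have in_ext_deg: "x0 \<in> ext_deg g d" "x1 \<in> ext_deg g (d - 1)" "x2 \<in> ext_deg g (d - 1)" "x3 \<in> ext_deg g (d - 2)"
      unfolding x0_def x1_def x2_def x3_def by (auto intro: proj_ext_deg[OF Suc.prems(1)])
    have "div_pow g s x3 + div_pow g t x0 \<in> ext_deg g (d - 2 + 2 * int s)"
      using in_ext_deg Suc by (intro ext_deg_add) (auto intro: div_pow_ext_deg)
    then have eqs: "div_pow g s x0 = 0" "div_pow g s x1 = 0" "div_pow g s x2 = 0"
        "div_pow g s x3 + div_pow g t x0 = 0"
      using adjoin_pair_eq_0[OF _ div_pow_ext_deg[OF in_ext_deg(1) refl] div_pow_ext_deg[OF in_ext_deg(2) refl]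
          div_pow_ext_deg[OF in_ext_deg(3) refl]] Suc.prems(3) 
      unfolding x Suc div_pow_adjoin_pair[OF in_ext_deg] by blast+
    have "x1 = 0" "x2 = 0"
      using Suc.IH[OF in_ext_deg(2) _ eqs(2)] Suc.IH[OF in_ext_deg(3) _ eqs(3)] Suc.prems(2) by simp_all
    \<comment> \<open>\<open>L\<close> produces \<open>(s + 1) L\<^sub>s\<^sub>+\<^sub>1 x3\<close>
      and \<open>s L\<^sub>s x0\<close>, and the latter is zero. The induction hypothesis applies to
      \<open>x3\<close> because its degree is lower by 2 while the order rises only by 1.\<close>
    moreover have "div_pow g 1 (div_pow g s x3 + div_pow g t x0) = 0" by (simp add: eqs)
    then have "div_pow g (Suc s) x3 = 0"
      using eqs(1) by (simp only: div_pow_add div_pow_Suc Suc) simp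
    then have "x3 = 0" using Suc.IH[OF in_ext_deg(4), of "Suc s"] Suc.prems(2) by simp
    moreover from this have "x0 = 0"
      using Suc.IH[OF in_ext_deg(1), of t] Suc.prems(2) eqs(4) \<open>s = Suc t\<close> by simp
    ultimately show ?thesis by (simp add: x adjoin_pair_def)
  qed
qed

text \<open>Additivity of the chosen preimage saves choosing a basis of the kernel of \<open>L\<close> later on.\<close>

lemma div_pow_section:
  assumes "s \<le> j"
  shows "\<exists>\<sigma>. additive \<sigma> \<and> (\<forall>q \<in> ext_deg g (int g + int j). div_pow g 1 q = 0 \<longrightarrow>
    \<sigma> q \<in> ext_deg g (int g + int j - 2 * int s) \<and> div_pow g s (\<sigma> q) = q)"
  using assms
proof (induction g arbitrary: j s)
  case 0
  show ?case
  proof (cases "j = 0")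
    case True
    then show ?thesis using 0 by (intro exI[of _ "\<lambda>q. q"]) (simp add: additive_def)
  next
    case False
    have "q = 0" if "q \<in> ext_deg 0 (int 0 + int j)" for q
      using ext_deg_empty[OF that] False by simp
    then show ?thesis by (intro exI[of _ "\<lambda>q. 0"]) (auto simp: additive_def)
  qed
next
  case (Suc g)
  show ?case
  proof (cases s)
    case 0
    then show ?thesis by (intro exI[of _ "\<lambda>q. q"]) (simp add: additive_def)
  next
    case s: (Suc t)
    \<comment> \<open>Write \<open>q\<close> by components. The sections serve \<open>q1\<close>,
      \<open>q2\<close> (\<open>sA\<close>), \<open>q0\<close> (\<open>s0\<close> of order
      \<open>s\<close> and \<open>s1\<close> of order \<open>Suc s\<close>) and a correction of
      \<open>q3\<close> (\<open>s3\<close>).\<close>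
    obtain sA where sA: "additive sA" "\<And>q. q \<in> ext_deg g (int g + int j) \<Longrightarrow> div_pow g 1 q = 0 \<Longrightarrow>
        sA q \<in> ext_deg g (int g + int j - 2 * int s) \<and> div_pow g s (sA q) = q"
      using Suc.IH[OF Suc.prems] by blast
    have "s \<le> Suc j" "Suc s \<le> Suc j" using Suc.prems by simp_all
    obtain s0 where s0: "additive s0" "\<And>q. q \<in> ext_deg g (int g + int (Suc j)) \<Longrightarrow> div_pow g 1 q = 0 \<Longrightarrow>
        s0 q \<in> ext_deg g (int g + int (Suc j) - 2 * int s) \<and> div_pow g s (s0 q) = q"
      using Suc.IH[OF \<open>s \<le> Suc j\<close>] by blast
    obtain s1 where s1: "additive s1" "\<And>q. q \<in> ext_deg g (int g + int (Suc j)) \<Longrightarrow> div_pow g 1 q = 0 \<Longrightarrow>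
        s1 q \<in> ext_deg g (int g + int (Suc j) - 2 * int (Suc s)) \<and> div_pow g (Suc s) (s1 q) = q"
      using Suc.IH[OF \<open>Suc s \<le> Suc j\<close>] by blast
    \<comment> \<open>The index belonging to the degree of \<open>q3\<close> is
      \<open>j - 1\<close>, so order \<open>s\<close> is available only if \<open>s < j\<close>. For
      \<open>s = j\<close> the order drops to \<open>s - 1 = t\<close>.\<close>
    define u where "u = (if s < j then s else j - 1)"
    have "u \<le> j - 1" using Suc.prems s by (auto simp: u_def)
    obtain s3 where s3: "additive s3" "\<And>q. q \<in> ext_deg g (int g + int (j - 1)) \<Longrightarrow> div_pow g 1 q = 0 \<Longrightarrow>
        s3 q \<in> ext_deg g (int g + int (j - 1) - 2 * int u) \<and> div_pow g u (s3 q) = q"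
      using Suc.IH[OF \<open>u \<le> j - 1\<close>] by blast
    \<comment> \<open>As \<open>L q3 = - q0\<close>, the component \<open>q3\<close> itself need not
      be in the kernel of \<open>L\<close>. The correction terms go to
      \<open>- s q0 + (s + 1) q0 = q0\<close> under \<open>L\<close>, so \<open>L z = 0\<close> and
      \<open>s3\<close> applies to \<open>z\<close>.\<close>
    define z where "z = (\<lambda>q0 q3. q3 - div_pow g t (s0 q0) + div_pow g s (s1 q0))"
    \<comment> \<open>For \<open>s < j\<close> the preimage of \<open>z\<close> has the degree of
      the top component. For \<open>s = j\<close> it has the degree of the first one, from where
      \<open>L\<^sub>t\<close> carries it to the top. In both cases the correction terms of
      \<open>z\<close> cancel there.\<close>
    define \<tau> where "\<tau> = (\<lambda>q0 q1 q2 q3. if s < j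
       then adjoin_pair g (s0 q0) (sA q1) (sA q2) (s3 (z q0 q3) - s1 q0)
       else adjoin_pair g (s0 q0 + s3 (z q0 q3)) (sA q1) (sA q2) (- s1 q0))"
    define \<sigma> where "\<sigma> = (\<lambda>q. \<tau> (proj g {} q) (proj g {2 * g} q) (proj g {2 * g + 1} q) (proj g {2 * g, 2 * g + 1} q))"
    note adds = additive.add[OF sA(1)] additive.add[OF s0(1)] additive.add[OF s1(1)] additive.add[OF s3(1)]
      additive.diff[OF s3(1)]
    have "additive \<sigma>"
      by (simp add: additive_def \<sigma>_def \<tau>_def z_def adjoin_pair_def adds proj_add ins_add ins_diff
          div_pow_add additive.minus[OF additive_ins] algebra_simps)
    moreover have "\<sigma> q \<in> ext_deg (Suc g) (int (Suc g) + int j - 2 * int s) \<and> div_pow (Suc g) s (\<sigma> q) = q"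
      if q_ext_deg: "q \<in> ext_deg (Suc g) (int (Suc g) + int j)" and Lq: "div_pow (Suc g) 1 q = 0" for q
    proof -
      define q0 q1 q2 q3 where "q0 = proj g {} q" and "q1 = proj g {2 * g} q"
        and "q2 = proj g {2 * g + 1} q" and "q3 = proj g {2 * g, 2 * g + 1} q"
      have q: "q = adjoin_pair g q0 q1 q2 q3"
        unfolding q0_def q1_def q2_def q3_def by (rule adjoin_pair_proj[OF q_ext_deg])
      have q_in: "q0 \<in> ext_deg g (int g + int (Suc j))" "q1 \<in> ext_deg g (int g + int j)" "q2 \<in> ext_deg g (int g + int j)"
          "q3 \<in> ext_deg g (int g + int (j - 1))"
        unfolding q0_def q1_def q2_def q3_def using s Suc.prems by (auto intro: proj_ext_deg[OF q_ext_deg])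
      have "div_pow g 1 q3 + q0 \<in> ext_deg g (int g + int (Suc j))"
        using q_in s Suc.prems by (intro ext_deg_add) (auto intro: div_pow_ext_deg)
      then have L: "div_pow g 1 q0 = 0" "div_pow g 1 q1 = 0" "div_pow g 1 q2 = 0" "div_pow g 1 q3 + q0 = 0"
        using adjoin_pair_eq_0[OF _ div_pow_ext_deg[OF q_in(1) refl] div_pow_ext_deg[OF q_in(2) refl]
          div_pow_ext_deg[OF q_in(3) refl], of 1 1 1] Lq
        unfolding q using div_pow_adjoin_pair[OF q_in, of 0] by auto
      note A1 = sA(2)[OF q_in(2) L(2)] and A2 = sA(2)[OF q_in(3) L(3)]
        and S0 = s0(2)[OF q_in(1) L(1)] and S1 = s1(2)[OF q_in(1) L(1)]
      have z_in: "z q0 q3 \<in> ext_deg g (int g + int (j - 1))"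
        unfolding z_def using q_in S0 S1 s Suc.prems
        by (intro ext_deg_add ext_deg_diff) (auto intro: div_pow_ext_deg)
      have "div_pow g 1 (z q0 q3) = div_pow g 1 q3 - frag_cmul (int s) q0 + frag_cmul (int (Suc s)) q0"
        using S0 S1 s by (simp only: z_def div_pow_add div_pow_diff div_pow_Suc)
      also have "\<dots> = div_pow g 1 q3 + q0"
        by (simp add: frag_cmul_distrib)
      finally have Lz: "div_pow g 1 (z q0 q3) = 0" using L by simp
      note S3 = s3(2)[OF z_in Lz]
      show ?thesis
      proof (cases "s < j")
        case True
        then have \<sigma>: "\<sigma> q = adjoin_pair g (s0 q0) (sA q1) (sA q2) (s3 (z q0 q3) - s1 q0)"
          by (simp add: \<sigma>_def \<tau>_def q0_def q1_def q2_def q3_def)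
        have "s3 (z q0 q3) - s1 q0 \<in> ext_deg g (int g + int (Suc j) - 2 * int s - 2)"
          using S3 S1 True s by (intro ext_deg_diff) (auto simp: u_def algebra_simps of_nat_diff)
        note in_ext_deg = conjunct1[OF S0] conjunct1[OF A1] conjunct1[OF A2] this
        have "\<sigma> q \<in> ext_deg (Suc g) (int (Suc g) + int j - 2 * int s)"
          unfolding \<sigma> using in_ext_deg by (intro adjoin_pair_ext_deg) (auto simp: algebra_simps)
        moreover have "div_pow (Suc g) s (\<sigma> q) = q"
          unfolding \<sigma> s div_pow_adjoin_pair[OF in_ext_deg] using A1 A2 S0 S3 True
          by (simp add: q s[symmetric] div_pow_diff u_def z_def)
        ultimately show ?thesis by simp
      next
        case False
        then have "s = j" using Suc.prems by simp
        have \<sigma>: "\<sigma> q = adjoin_pair g (s0 q0 + s3 (z q0 q3)) (sA q1) (sA q2) (- s1 q0)"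
          using False by (simp add: \<sigma>_def \<tau>_def q0_def q1_def q2_def q3_def)
        have u: "u = t" using False \<open>s = j\<close> s by (simp add: u_def)
        have "s0 q0 + s3 (z q0 q3) \<in> ext_deg g (int g + int (Suc j) - 2 * int s)"
          using S3 S0 \<open>s = j\<close> s by (intro ext_deg_add) (auto simp: u algebra_simps)
        moreover have "- s1 q0 \<in> ext_deg g (int g + int (Suc j) - 2 * int s - 2)"
          using S1 by (intro ext_deg_minus) (auto simp: algebra_simps)
        ultimately have in_ext_deg: "s0 q0 + s3 (z q0 q3) \<in> ext_deg g (int g + int (Suc j) - 2 * int s)"
          "sA q1 \<in> ext_deg g (int g + int j - 2 * int s)" "sA q2 \<in> ext_deg g (int g + int j - 2 * int s)"
          "- s1 q0 \<in> ext_deg g (int g + int (Suc j) - 2 * int s - 2)"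
          using A1 A2 by auto
        \<comment> \<open>The summand \<open>s3 z\<close> in the first component must not disturb
          \<open>q0\<close>:
          \<open>s L\<^sub>s (s3 z) = L L\<^sub>t (s3 z) = L z = 0\<close>.\<close>
        have "frag_cmul (int s) (div_pow g s (s3 (z q0 q3))) = div_pow g 1 (div_pow g t (s3 (z q0 q3)))"
          by (simp only: div_pow_Suc s)
        also have "\<dots> = 0" using S3 Lz u by simp
        finally have w: "div_pow g s (s3 (z q0 q3)) = 0" using s by simp
        have "\<sigma> q \<in> ext_deg (Suc g) (int (Suc g) + int j - 2 * int s)"
          unfolding \<sigma> using in_ext_deg by (intro adjoin_pair_ext_deg) (auto simp: algebra_simps)
        moreover have "div_pow (Suc g) s (\<sigma> q) = q"
          unfolding \<sigma> s div_pow_adjoin_pair[OF in_ext_deg] using A1 A2 S0 S3 w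
          by (simp add: q s[symmetric] div_pow_add div_pow_minus u z_def)
        ultimately show ?thesis by simp
      qed
    qed
    ultimately show ?thesis by blast
  qed
qed

section \<open>The splitting\<close>

text \<open>An \<open>n\<close>-fold difference of \<open>m \<mapsto> m choose k\<close>: by
  Pascal's rule each difference lowers both indices by 1. The case \<open>k = n\<close>, with value
  1, normalizes the section below.\<close>

lemma sum_choose_alternating:
  assumes "n \<le> k" "n \<le> m"
  shows "(\<Sum>s\<le>n. (-1) ^ s * int (n choose s) * int ((m - s) choose k)) = int ((m - n) choose (k - n))"
  using assms
proof (induction n arbitrary: m)
  case 0
  then show ?case by simp
next
  case (Suc n)
  let ?f = "\<lambda>n m s. (-1) ^ s * int (n choose s) * int ((m - s) choose k)"
  have "(\<Sum>s\<le>Suc n. ?f (Suc n) m s) = ?f n m 0 + (\<Sum>s\<le>n. ?f (Suc n) m (Suc s))"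
    by (subst sum.atMost_Suc_shift) simp
  also have "(\<Sum>s\<le>n. ?f (Suc n) m (Suc s)) = (\<Sum>s\<le>n. ?f n m (Suc s)) - (\<Sum>s\<le>n. ?f n (m - 1) s)"
    by (subst sum_subtractf[symmetric]) (intro sum.cong refl, simp add: algebra_simps)
  also have "?f n m 0 + ((\<Sum>s\<le>n. ?f n m (Suc s)) - (\<Sum>s\<le>n. ?f n (m - 1) s)) =
      (\<Sum>s\<le>Suc n. ?f n m s) - (\<Sum>s\<le>n. ?f n (m - 1) s)"
    by (simp only: sum.atMost_Suc_shift[of "?f n m" n] add_diff_eq)
  also have "\<dots> = (\<Sum>s\<le>n. ?f n m s) - (\<Sum>s\<le>n. ?f n (m - 1) s)" by simp
  also have "\<dots> = int ((m - n) choose (k - n)) - int ((m - 1 - n) choose (k - n))"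
    using Suc.IH[of m] Suc.IH[of "m - 1"] Suc.prems by simp
  also have "\<dots> = int ((m - Suc n) choose (k - Suc n))"
  proof -
    obtain m' k' where "m - n = Suc m'" "k - n = Suc k'"
      using Suc.prems by (metis Suc_diff_le diff_Suc_Suc Suc_le_eq le_Suc_ex zero_less_diff gr0_implies_Suc)
    moreover from this have "m - 1 - n = m'" "m - Suc n = m'" "k - Suc n = k'" by simp_all
    ultimately show ?thesis by simp
  qed
  finally show ?case .
qed

lemma frag_cmul_sum_left: "(\<Sum>s\<in>A. frag_cmul (c s) x) = frag_cmul (\<Sum>s\<in>A. c s) x"
  by (induction A rule: infinite_finite_induct) (simp_all add: frag_cmul_distrib)

text \<open>With \<open>y s\<close> a preimage of \<open>q\<close> under
  \<open>L\<^sub>j\<^sub>-\<^sub>s\<close>, where \<open>j = i + 2 r\<close>, the map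
  \<open>L\<^sub>r\<close> sends \<open>L\<^sub>i\<^sub>+\<^sub>r\<^sub>-\<^sub>s (y s)\<close> to
  \<open>(j - s) choose r\<close> times \<open>q\<close>. The alternating weights make these
  multiples add up to 1.\<close>

lemma div_pow_split_section:
  "\<exists>\<tau>. additive \<tau> \<and> (\<forall>q \<in> ext_deg g (int g + int i + 2 * int r). div_pow g 1 q = 0 \<longrightarrow>
    \<tau> q \<in> ext_deg g (int g + int i) \<and> div_pow g r (\<tau> q) = q \<and>
    (\<exists>z \<in> ext_deg g (int g - int i). div_pow g i z = frag_cmul (int ((r + i) choose i)) (\<tau> q)))"
proof -
  define j where "j = i + 2 * r"
  have "\<exists>\<sigma>. additive \<sigma> \<and> (\<forall>q \<in> ext_deg g (int g + int j). div_pow g 1 q = 0 \<longrightarrow>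
    \<sigma> q \<in> ext_deg g (int g + int j - 2 * int (j - s)) \<and> div_pow g (j - s) (\<sigma> q) = q)" for s
    by (rule div_pow_section) simp
  then obtain y where y: "\<And>s. additive (y s)" "\<And>s q. q \<in> ext_deg g (int g + int j) \<Longrightarrow> div_pow g 1 q = 0 \<Longrightarrow>
    y s q \<in> ext_deg g (int g + int j - 2 * int (j - s)) \<and> div_pow g (j - s) (y s q) = q"
    by metis
  define \<tau> where "\<tau> = (\<lambda>q. \<Sum>s\<le>r. frag_cmul ((-1) ^ s * int (r choose s)) (div_pow g (i + r - s) (y s q)))"
  have "additive \<tau>"
    by (simp add: additive_def \<tau>_def additive.add[OF y(1)] div_pow_add frag_cmul_distrib2 sum.distrib)
  moreover have "\<tau> q \<in> ext_deg g (int g + int i) \<and> div_pow g r (\<tau> q) = q \<and>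
    (\<exists>z \<in> ext_deg g (int g - int i). div_pow g i z = frag_cmul (int ((r + i) choose i)) (\<tau> q))"
    if q: "q \<in> ext_deg g (int g + int i + 2 * int r)" "div_pow g 1 q = 0" for q
  proof (intro conjI bexI)
    have Y: "y s q \<in> ext_deg g (int g - int j + 2 * int s)" "div_pow g (j - s) (y s q) = q" if "s \<le> r" for s
      using y(2)[of q s] q that by (simp_all add: j_def of_nat_diff algebra_simps)
    show "\<tau> q \<in> ext_deg g (int g + int i)"
      unfolding \<tau>_def
    proof (intro ext_deg_sum ext_deg_cmul)
      fix s assume "s \<in> {..r}"
      then show "div_pow g (i + r - s) (y s q) \<in> ext_deg g (int g + int i)"
        by (intro div_pow_ext_deg[OF Y(1)]) (simp_all add: j_def of_nat_diff)
    qed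
    \<comment> \<open>Obtained by dividing \<open>\<tau> q\<close> by \<open>L\<^sub>i\<close> term
      by term; the weights \<open>(r + i) choose s\<close> absorb the binomial coefficient of
      \<open>L\<^sub>i L\<^sub>r\<^sub>-\<^sub>s\<close>.\<close>
    define z where "z = (\<Sum>s\<le>r. frag_cmul ((-1) ^ s * int ((r + i) choose s)) (div_pow g (r - s) (y s q)))"
    show "z \<in> ext_deg g (int g - int i)"
      unfolding z_def
    proof (intro ext_deg_sum ext_deg_cmul)
      fix s assume "s \<in> {..r}"
      then show "div_pow g (r - s) (y s q) \<in> ext_deg g (int g - int i)"
        by (intro div_pow_ext_deg[OF Y(1)]) (simp_all add: j_def of_nat_diff)
    qed
    have "div_pow g r (\<tau> q) =
        (\<Sum>s\<le>r. frag_cmul ((-1) ^ s * int (r choose s) * int ((j - s) choose r)) q)"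
      unfolding \<tau>_def div_pow_sum div_pow_cmul
    proof (rule sum.cong)
      fix s assume "s \<in> {..r}"
      moreover from this have "r + (i + r - s) = j - s" by (simp add: j_def)
      ultimately show "frag_cmul ((-1) ^ s * int (r choose s)) (div_pow g r (div_pow g (i + r - s) (y s q))) =
          frag_cmul ((-1) ^ s * int (r choose s) * int ((j - s) choose r)) q"
        using Y(2)[of s] by (simp add: div_pow_mult)
    qed simp
    also have "\<dots> = frag_cmul (\<Sum>s\<le>r. (-1) ^ s * int (r choose s) * int ((j - s) choose r)) q"
      by (rule frag_cmul_sum_left)
    also have "\<dots> = q"
      by (subst sum_choose_alternating) (simp_all add: j_def)
    finally show "div_pow g r (\<tau> q) = q" .
    show "div_pow g i z = frag_cmul (int ((r + i) choose i)) (\<tau> q)"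
      unfolding \<tau>_def z_def div_pow_sum div_pow_cmul frag_cmul_sum
    proof (rule sum.cong)
      fix s assume "s \<in> {..r}"
      then have s: "s \<le> r" by simp
      \<comment> \<open>Both products are the trinomial coefficient for splitting
        \<open>r + i\<close> into parts of sizes \<open>s\<close>, \<open>i\<close> and
        \<open>r - s\<close>.\<close>
      have "((r + i) choose s) * ((r + i - s) choose i) = ((r + i) choose r) * (r choose s)"
        using choose_mult[OF s, of "r + i"] binomial_symmetric[of i "r + i - s"] s by simp
      also have "(r + i) choose r = (r + i) choose i"
        using binomial_symmetric[of i "r + i"] by simp
      finally have "int ((r + i) choose s) * int ((r + i - s) choose i) = int ((r + i) choose i) * int (r choose s)"
        by (metis of_nat_mult)
      moreover have "i + (r - s) = r + i - s" "i + r - s = r + i - s" using s by simp_all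
      ultimately show "frag_cmul ((-1) ^ s * int ((r + i) choose s)) (div_pow g i (div_pow g (r - s) (y s q))) =
          frag_cmul (int ((r + i) choose i)) (frag_cmul ((-1) ^ s * int (r choose s)) (div_pow g (i + r - s) (y s q)))"
        by (simp add: div_pow_mult mult.assoc mult.left_commute)
    qed simp
  qed
  ultimately show ?thesis by blast
qed

section \<open>The action of the symplectic group\<close>

lemma wedge_ext_deg:
  assumes "x \<in> ext_deg g a" "y \<in> ext_deg g b" "c = a + b"
  shows "x \<^bold>\<and> y \<in> ext_deg g c"
proof (rule additive_ext_deg[OF additive_wedge_left assms(1)])
  fix I assume I: "I \<subseteq> {..<2 * g}" "int (card I) = a"
  show "frag_of I \<^bold>\<and> y \<in> ext_deg g c"
  proof (rule additive_ext_deg[OF additive_wedge_right assms(2)])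
    fix J assume J: "J \<subseteq> {..<2 * g}" "int (card J) = b"
    have "finite I" "finite J" using I J finite_subset by blast+
    then show "frag_of I \<^bold>\<and> frag_of J \<in> ext_deg g c"
      using I J assms(3) by (auto simp: wedge_monom_def card_Un_disjoint ext_deg_frag_of intro!: ext_deg_cmul)
  qed
qed

lemma wedge_assoc_ext_deg: "x \<in> ext_deg g a \<Longrightarrow> y \<in> ext_deg g b \<Longrightarrow> (x \<^bold>\<and> y) \<^bold>\<and> z = x \<^bold>\<and> y \<^bold>\<and> z"
  by (intro wedge_assoc ext_deg_finite)

lemma mat_col_ext_ext_deg: "dim_row A = 2 * g \<Longrightarrow> mat_col_ext A j \<in> ext_deg g 1"
  unfolding mat_col_ext_def by (intro ext_deg_sum ext_deg_cmul) (simp add: ext_deg_frag_of)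

lemma ext_deg_1_anticommute:
  assumes "x \<in> ext_deg g 1" "y \<in> ext_deg g 1"
  shows "x \<^bold>\<and> y = - (y \<^bold>\<and> x)"
proof (rule additive_eq_on_ext_deg[OF additive_wedge_left _ assms(1)])
  show "additive (\<lambda>x. - (y \<^bold>\<and> x))" by (simp add: additive_def wedge_add_right)
  fix I :: "nat set" assume "int (card I) = 1"
  then obtain a where I: "I = {a}" by (auto simp: card_1_singleton_iff)
  show "frag_of I \<^bold>\<and> y = - (y \<^bold>\<and> frag_of I)"
  proof (rule additive_eq_on_ext_deg[OF additive_wedge_right _ assms(2)])
    show "additive (\<lambda>y. - (y \<^bold>\<and> frag_of I))" by (simp add: additive_def wedge_add_left)
    fix J :: "nat set" assume "int (card J) = 1"
    then obtain b where J: "J = {b}" by (auto simp: card_1_singleton_iff)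
    have "{(a', b'). a' \<in> {a} \<and> b' \<in> {b} \<and> b' < a'} = (if b < a then {(a, b)} else {})" for a b :: nat
      by auto
    note inv = this[of a b] this[of b a]
    show "frag_of I \<^bold>\<and> frag_of J = - (frag_of J \<^bold>\<and> frag_of I)"
      unfolding I J wedge_frag_of wedge_monom_def inv by (auto simp: insert_commute)
  qed
qed

text \<open>Anticommutation only yields \<open>2 (x \<and> x) = 0\<close>; torsion-freeness does the
  rest.\<close>

lemma ext_deg_1_square: "x \<in> ext_deg g 1 \<Longrightarrow> x \<^bold>\<and> x = 0"
proof -
  assume "x \<in> ext_deg g 1"
  from ext_deg_1_anticommute[OF this this] have "x \<^bold>\<and> x + x \<^bold>\<and> x = 0"
    by (metis add.right_inverse)
  then have "frag_cmul 2 (x \<^bold>\<and> x) = 0"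
    using frag_cmul_distrib[of 1 1 "x \<^bold>\<and> x"] by simp
  then show ?thesis by simp
qed

lemma wedge_singleton_less:
  "\<forall>k\<in>K. m < k \<Longrightarrow> frag_of {m} \<^bold>\<and> frag_of K = frag_of (insert m K)"
proof -
  assume K: "\<forall>k\<in>K. m < k"
  then have inv: "invs {m} K = {}" by auto
  show ?thesis using K unfolding wedge_frag_of wedge_monom_def inv by auto
qed

lemma additive_ext_act: "additive (ext_act A)"
  unfolding ext_act_def by (rule additive_frag_extend)

lemmas ext_act_add = additive.add[OF additive_ext_act]
  and ext_act_zero [simp] = additive.zero[OF additive_ext_act]
  and ext_act_minus = additive.minus[OF additive_ext_act]
  and ext_act_sum = additive.sum[OF additive_ext_act]
  and ext_act_cmul = additive_frag_cmul[OF additive_ext_act]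

lemma ext_act_empty [simp]: "ext_act A (frag_of {}) = frag_of {}"
  by (simp add: ext_act_def)

text \<open>\<open>ext_act\<close> folds over the increasing list of indices, so the least one
  splits off in front. The inductions by \<open>finite_linorder_min_induct\<close> use this
  recursion.\<close>

lemma ext_act_insert:
  assumes "finite K" "\<forall>k\<in>K. m < k"
  shows "ext_act A (frag_of (insert m K)) = mat_col_ext A m \<^bold>\<and> ext_act A (frag_of K)"
proof -
  have "m \<notin> K" using assms(2) by blast
  then have "sorted_list_of_set (insert m K) = insort m (sorted_list_of_set K)"
    using assms(1) by simp
  also have "\<dots> = m # sorted_list_of_set K"
    using assms by (intro insort_is_Cons) (simp add: less_imp_le)
  finally show ?thesis by (simp add: ext_act_def)
qed

lemma wedge_empty_left [simp]: "frag_of {} \<^bold>\<and> x = x"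
  by (rule additive_eqI[where x = x and S = UNIV, OF additive_wedge_right])
     (auto simp: wedge_monom_def additive_def)

lemma wedge_empty_right [simp]: "x \<^bold>\<and> frag_of {} = x"
  by (rule additive_eqI[where x = x and S = UNIV, OF additive_wedge_left])
     (auto simp: wedge_monom_def additive_def)

lemma ext_act_singleton: "ext_act A (frag_of {a}) = mat_col_ext A a"
  using ext_act_insert[of "{}" a A] by simp

lemma ext_act_ext_deg_finite:
  assumes "finite I" "dim_row A = 2 * g"
  shows "ext_act A (frag_of I) \<in> ext_deg g (int (card I))"
  using assms(1)
proof (induction I rule: finite_linorder_min_induct)
  case empty
  then show ?case by (simp add: ext_deg_frag_of)
next
  case (insert b I)
  then have "b \<notin> I" by blast
  with insert show ?case
    by (simp add: ext_act_insert wedge_ext_deg[OF mat_col_ext_ext_deg[OF assms(2)]])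
qed

lemma ext_act_ext_deg:
  assumes "x \<in> ext_deg g d" "dim_row A = 2 * g"
  shows "ext_act A x \<in> ext_deg g d"
proof (rule additive_ext_deg[OF additive_ext_act assms(1)])
  fix I assume "I \<subseteq> {..<2 * g}" "int (card I) = d"
  then show "ext_act A (frag_of I) \<in> ext_deg g d"
    using ext_act_ext_deg_finite[OF _ assms(2), of I] finite_subset by blast
qed

lemma wedge_monom_singleton_cases:
  assumes "a \<notin> K"
  shows "\<exists>c. frag_of {a} \<^bold>\<and> frag_of K = frag_cmul c (frag_of (insert a K))"
  using assms by (auto simp: wedge_monom_def)

text \<open>Induction with \<open>b\<close> the least index of the second factor. For
  \<open>a < b\<close> the product is already sorted, and for \<open>a = b\<close> both sides
  vanish. For \<open>b < a\<close> the index \<open>a\<close> moves past \<open>b\<close>, and the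
  image columns, being of degree one, anticommute in the same way.\<close>

lemma ext_act_wedge_singleton:
  assumes "finite K" "dim_row A = 2 * g"
  shows "ext_act A (frag_of {a} \<^bold>\<and> frag_of K) = mat_col_ext A a \<^bold>\<and> ext_act A (frag_of K)"
  using assms(1)
proof (induction K rule: finite_linorder_min_induct)
  case empty
  then show ?case by (simp only: wedge_empty_right ext_act_empty ext_act_singleton)
next
  case (insert b K)
  note v = mat_col_ext_ext_deg[OF assms(2)]
  note eb = wedge_singleton_less[OF insert(2)]
  consider "a < b" | "a = b" | "b < a" by linarith
  then show ?case
  proof cases
    case 1
    then have "\<forall>k\<in>insert b K. a < k" using insert(2) by auto
    then show ?thesis using insert(1) by (simp only: wedge_singleton_less ext_act_insert finite_insert)
  next
    case 2
    have "frag_of {a} \<^bold>\<and> frag_of (insert b K) = 0" using 2 by (simp add: wedge_monom_def)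
    moreover have "mat_col_ext A a \<^bold>\<and> mat_col_ext A b \<^bold>\<and> ext_act A (frag_of K) = 0"
      using wedge_assoc_ext_deg[OF v v] ext_deg_1_square[OF v] 2 by (metis wedge_zero_left)
    ultimately show ?thesis by (simp only: ext_act_insert[OF insert(1,2)] ext_act_zero)
  next
    case 3
    \<comment> \<open>\<open>Suc (a + b)\<close> is just a genus large enough to contain both
      indices.\<close>
    have sa: "frag_of {a} \<in> ext_deg (Suc (a + b)) 1" and sb: "frag_of {b} \<in> ext_deg (Suc (a + b)) 1"
      by (simp_all add: ext_deg_frag_of)
    have "frag_of {a} \<^bold>\<and> frag_of (insert b K) = (frag_of {a} \<^bold>\<and> frag_of {b}) \<^bold>\<and> frag_of K"
      by (simp only: wedge_assoc_ext_deg[OF sa sb] eb)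
    also have "\<dots> = - ((frag_of {b} \<^bold>\<and> frag_of {a}) \<^bold>\<and> frag_of K)"
      by (simp only: ext_deg_1_anticommute[OF sa sb] wedge_minus_left)
    also have "(frag_of {b} \<^bold>\<and> frag_of {a}) \<^bold>\<and> frag_of K = frag_of {b} \<^bold>\<and> frag_of {a} \<^bold>\<and> frag_of K"
      by (rule wedge_assoc_ext_deg[OF sb sa])
    finally have swap: "frag_of {a} \<^bold>\<and> frag_of (insert b K) = - (frag_of {b} \<^bold>\<and> frag_of {a} \<^bold>\<and> frag_of K)" .
    have "ext_act A (frag_of {b} \<^bold>\<and> frag_of {a} \<^bold>\<and> frag_of K) =
        mat_col_ext A b \<^bold>\<and> ext_act A (frag_of {a} \<^bold>\<and> frag_of K)"
    proof (cases "a \<in> K")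
      case True
      then have "frag_of {a} \<^bold>\<and> frag_of K = 0" by (simp add: wedge_monom_def)
      then show ?thesis by (simp only: wedge_zero_right ext_act_zero)
    next
      case False
      then obtain c where c: "frag_of {a} \<^bold>\<and> frag_of K = frag_cmul c (frag_of (insert a K))"
        using wedge_monom_singleton_cases by blast
      have "\<forall>k\<in>insert a K. b < k" using insert(2) 3 by auto
      then show ?thesis
        unfolding c using insert(1)
        by (simp only: wedge_cmul_right ext_act_cmul wedge_singleton_less ext_act_insert finite_insert)
    qed
    also have "\<dots> = mat_col_ext A b \<^bold>\<and> mat_col_ext A a \<^bold>\<and> ext_act A (frag_of K)"
      by (simp only: insert.IH)
    also have "\<dots> = (mat_col_ext A b \<^bold>\<and> mat_col_ext A a) \<^bold>\<and> ext_act A (frag_of K)"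
      by (simp only: wedge_assoc_ext_deg[OF v v])
    also have "\<dots> = - ((mat_col_ext A a \<^bold>\<and> mat_col_ext A b) \<^bold>\<and> ext_act A (frag_of K))"
      by (simp only: ext_deg_1_anticommute[OF v v, of b a] wedge_minus_left)
    finally show ?thesis
      unfolding swap by (simp only: ext_act_minus ext_act_insert[OF insert(1,2)] wedge_assoc_ext_deg[OF v v] minus_minus)
  qed
qed

lemma ext_act_wedge_monom:
  assumes "finite I" "finite K" "dim_row A = 2 * g"
  shows "ext_act A (frag_of I \<^bold>\<and> frag_of K) = ext_act A (frag_of I) \<^bold>\<and> ext_act A (frag_of K)"
  using assms(1)
proof (induction I rule: finite_linorder_min_induct)
  case empty
  then show ?case by (simp only: wedge_empty_left ext_act_empty)
next
  case (insert b I)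
  have fin: "Poly_Mapping.keys (frag_of {b} :: ext) \<subseteq> Collect finite"
    "Poly_Mapping.keys (frag_of I :: ext) \<subseteq> Collect finite" using insert(1) by simp_all
  have IK: "Poly_Mapping.keys (frag_of I \<^bold>\<and> frag_of K) \<subseteq> Collect finite"
    using insert(1) assms(2) by (auto simp: wedge_monom_def)
  have "ext_act A (frag_of (insert b I) \<^bold>\<and> frag_of K) = ext_act A (frag_of {b} \<^bold>\<and> frag_of I \<^bold>\<and> frag_of K)"
    by (simp only: wedge_singleton_less[OF insert(2), symmetric] wedge_assoc[OF fin])
  also have "\<dots> = mat_col_ext A b \<^bold>\<and> ext_act A (frag_of I \<^bold>\<and> frag_of K)"
    by (rule additive_eqI[OF additive_compose[OF additive_ext_act additive_wedge_right]
          additive_compose[OF additive_wedge_right additive_ext_act] IK])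
       (rule ext_act_wedge_singleton[OF _ assms(3)], simp)
  also have "\<dots> = (mat_col_ext A b \<^bold>\<and> ext_act A (frag_of I)) \<^bold>\<and> ext_act A (frag_of K)"
    by (simp only: insert.IH wedge_assoc_ext_deg[OF mat_col_ext_ext_deg[OF assms(3)] ext_act_ext_deg_finite[OF insert(1) assms(3)]])
  finally show ?case by (simp only: ext_act_insert[OF insert(1,2)])
qed

lemma ext_act_wedge:
  assumes "x \<in> ext_deg g a" "y \<in> ext_deg g b" "dim_row A = 2 * g"
  shows "ext_act A (x \<^bold>\<and> y) = ext_act A x \<^bold>\<and> ext_act A y"
proof (rule additive_eq_on_ext_deg[OF additive_compose[OF additive_ext_act additive_wedge_left]
      additive_compose[OF additive_wedge_left additive_ext_act] assms(1)])
  fix I assume I: "I \<subseteq> {..<2 * g}"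
  show "ext_act A (frag_of I \<^bold>\<and> y) = ext_act A (frag_of I) \<^bold>\<and> ext_act A y"
  proof (rule additive_eq_on_ext_deg[OF additive_compose[OF additive_ext_act additive_wedge_right]
      additive_compose[OF additive_wedge_right additive_ext_act] assms(2)])
    fix J assume J: "J \<subseteq> {..<2 * g}"
    have "finite I" "finite J" using I J finite_subset by blast+
    then show "ext_act A (frag_of I \<^bold>\<and> frag_of J) = ext_act A (frag_of I) \<^bold>\<and> ext_act A (frag_of J)"
      by (rule ext_act_wedge_monom[OF _ _ assms(3)])
  qed
qed

text \<open>The action is multiplicative, so the claim reduces to degree one, where it is the
  formula for the columns of a matrix product.\<close>

lemma ext_act_mult:
  assumes "A \<in> carrier_mat (2 * g) (2 * g)" "B \<in> carrier_mat (2 * g) (2 * g)" "x \<in> ext_deg g d"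
  shows "ext_act A (ext_act B x) = ext_act (A * B) x"
proof (rule additive_eq_on_ext_deg[OF additive_compose[OF additive_ext_act additive_ext_act] additive_ext_act assms(3)])
  have dims: "dim_row A = 2 * g" "dim_row B = 2 * g" "dim_row (A * B) = 2 * g" "dim_col A = 2 * g" "dim_col B = 2 * g"
    using assms by auto
  have col: "ext_act A (mat_col_ext B b) = mat_col_ext (A * B) b" if "b < 2 * g" for b
  proof -
    have "ext_act A (mat_col_ext B b) =
        (\<Sum>a<2 * g. \<Sum>c<2 * g. frag_cmul (A $$ (c, a) * B $$ (a, b)) (frag_of {c}))"
      unfolding mat_col_ext_def[of B] ext_act_sum ext_act_cmul ext_act_singleton dims
      by (simp add: mat_col_ext_def dims frag_cmul_sum mult.commute)
    also have "\<dots> = (\<Sum>c<2 * g. \<Sum>a<2 * g. frag_cmul (A $$ (c, a) * B $$ (a, b)) (frag_of {c}))"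
      by (rule sum.swap)
    also have "\<dots> = mat_col_ext (A * B) b"
      unfolding mat_col_ext_def[of "A * B"] dims
      by (rule sum.cong) (use that dims in \<open>simp_all add: frag_cmul_sum_left scalar_prod_def lessThan_atLeast0\<close>)
    finally show ?thesis .
  qed
  fix I assume I: "I \<subseteq> {..<2 * g}"
  have "finite I" using I finite_subset by blast
  then show "ext_act A (ext_act B (frag_of I)) = ext_act (A * B) (frag_of I)"
    using I
  proof (induction I rule: finite_linorder_min_induct)
    case empty
    then show ?case by simp
  next
    case (insert b I)
    then show ?case
      by (simp add: ext_act_insert ext_act_wedge[OF mat_col_ext_ext_deg ext_act_ext_deg_finite] dims col)
  qed
qed

lemma ext_act_one:
  assumes "x \<in> ext_deg g d"
  shows "ext_act (1\<^sub>m (2 * g)) x = x"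
proof (rule additive_eq_on_ext_deg[OF additive_ext_act _ assms])
  have col: "mat_col_ext (1\<^sub>m (2 * g)) b = frag_of {b}" if "b < 2 * g" for b
  proof -
    have "mat_col_ext (1\<^sub>m (2 * g)) b = (\<Sum>a<2 * g. if a = b then frag_of {a} else 0)"
      unfolding mat_col_ext_def using that by (intro sum.cong) auto
    then show ?thesis using that by simp
  qed
  fix I assume I: "I \<subseteq> {..<2 * g}"
  have "finite I" using I finite_subset by blast
  then show "ext_act (1\<^sub>m (2 * g)) (frag_of I) = frag_of I"
    using I
  proof (induction I rule: finite_linorder_min_induct)
    case (insert b I)
    then show ?case
      using wedge_singleton_less[OF insert(2)] by (simp add: ext_act_insert col del: wedge_frag_of)
  qed simp
qed (simp add: additive_def)

section \<open>The symplectic form and inverses of symplectic matrices\<close>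

lemma symp_form_carrier: "symp_form g \<in> carrier_mat (2 * g) (2 * g)"
  by (simp add: symp_form_def)

lemma pair_union_lessThan: "pair_union {..<g} = {..<2 * g}"
proof (rule Set.set_eqI)
  fix x :: nat show "x \<in> pair_union {..<g} \<longleftrightarrow> x \<in> {..<2 * g}"
  proof (cases "even x")
    case True
    then show ?thesis by (elim evenE) simp
  next
    case False
    then obtain j where "x = Suc (2 * j)" by (metis oddE Suc_eq_plus1)
    then show ?thesis by simp presburger
  qed
qed

lemma sum_lessThan_double: "(\<Sum>a<2 * (g :: nat). f a) = (\<Sum>j<g. f (2 * j) + f (2 * j + 1))"
  by (simp only: pair_union_lessThan[symmetric] sum_pair_union[OF finite_lessThan])

lemma sum_symp_form_right:
  fixes h :: "nat \<Rightarrow> int"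
  assumes "j < g"
  shows "(\<Sum>b<2 * g. symp_form g $$ (2 * j, b) * h b) = h (2 * j + 1)"
    and "(\<Sum>b<2 * g. symp_form g $$ (2 * j + 1, b) * h b) = - h (2 * j)"
proof -
  have "(\<Sum>b<2 * g. symp_form g $$ (2 * j, b) * h b) = (\<Sum>b<2 * g. if b = 2 * j + 1 then h b else 0)"
    using assms by (intro sum.cong refl) (simp add: symp_form_def)
  then show "(\<Sum>b<2 * g. symp_form g $$ (2 * j, b) * h b) = h (2 * j + 1)"
    using assms by simp
  have "(\<Sum>b<2 * g. symp_form g $$ (2 * j + 1, b) * h b) = (\<Sum>b<2 * g. if b = 2 * j then - h b else 0)"
    using assms by (intro sum.cong refl) (auto simp: symp_form_def)
  then show "(\<Sum>b<2 * g. symp_form g $$ (2 * j + 1, b) * h b) = - h (2 * j)"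
    using assms by simp
qed

lemma symp_form_square: "symp_form g * symp_form g = - 1\<^sub>m (2 * g)"
proof (rule eq_matI)
  fix a c assume "a < dim_row (- 1\<^sub>m (2 * g) :: int mat)" "c < dim_col (- 1\<^sub>m (2 * g) :: int mat)"
  then have ac: "a < 2 * g" "c < 2 * g" by simp_all
  have prod: "(symp_form g * symp_form g) $$ (a, c) =
      (\<Sum>b<2 * g. symp_form g $$ (a, b) * symp_form g $$ (b, c))"
    using ac symp_form_carrier[of g] by (simp add: scalar_prod_def lessThan_atLeast0)
  have "a \<in> pair_union {..<g}" using ac by (simp add: pair_union_lessThan)
  then obtain j where j: "j < g" "a = 2 * j \<or> a = 2 * j + 1" by (auto simp: pair_union_def)
  then show "(symp_form g * symp_form g) $$ (a, c) = (- 1\<^sub>m (2 * g) :: int mat) $$ (a, c)"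
    unfolding prod using ac
    by (elim conjE disjE)
       (simp_all only: sum_symp_form_right, auto simp: symp_form_def)
qed (use symp_form_carrier[of g] in auto)

text \<open>Over a field a one-sided inverse of a square matrix is two-sided; the entrywise
  embedding into the rationals is injective.\<close>

lemma int_mat_mult_left_right_inverse:
  fixes A B :: "int mat"
  assumes "A \<in> carrier_mat n n" "B \<in> carrier_mat n n" "A * B = 1\<^sub>m n"
  shows "B * A = 1\<^sub>m n"
proof -
  let ?h = "map_mat rat_of_int"
  have "?h A * ?h B = 1\<^sub>m n"
    using of_int_hom.mat_hom_mult[OF assms(1,2)] assms(3) by (metis of_int_hom.mat_hom_one)
  then have "?h B * ?h A = 1\<^sub>m n"
    using mat_mult_left_right_inverse[of "?h A" n "?h B"] assms by simp
  then have "?h (B * A) = ?h (1\<^sub>m n)"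
    using of_int_hom.mat_hom_mult[OF assms(2,1)] by (metis of_int_hom.mat_hom_one)
  then show ?thesis by (rule of_int_hom.mat_hom_inj)
qed

text \<open>Inverses provide \<open>act_inverse\<close> for the modules below. The last conjunct is
  needed because the coefficient matrix of the bivector \<open>\<omega>\<close> transforms by
  \<open>A J A\<^sup>T\<close>, whereas \<open>Sp\<close> is defined by
  \<open>A\<^sup>T J A\<close>.\<close>

lemma Sp_inverse:
  assumes "A \<in> Sp g"
  shows "\<exists>B \<in> Sp g. A * B = 1\<^sub>m (2 * g) \<and> A * symp_form g * transpose_mat A = symp_form g"
proof -
  define J where "J = symp_form g"
  define At where "At = transpose_mat A"
  \<comment> \<open>Solving \<open>A\<^sup>T J A = J\<close> for the inverse of \<open>A\<close>
    gives \<open>J\<^sup>-\<^sup>1 A\<^sup>T J\<close>, and the inverse of \<open>J\<close> is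
    \<open>- J\<close>.\<close>
  define B where "B = - (J * At * J)"
  have A: "A \<in> carrier_mat (2 * g) (2 * g)" and sym: "At * J * A = J"
    using assms by (auto simp: Sp_def J_def At_def)
  have J: "J \<in> carrier_mat (2 * g) (2 * g)" by (simp add: J_def symp_form_carrier)
  have At: "At \<in> carrier_mat (2 * g) (2 * g)" using A by (simp add: At_def)
  have B: "B \<in> carrier_mat (2 * g) (2 * g)" using J At by (simp add: B_def)
  have JJ: "J * J = - 1\<^sub>m (2 * g)" by (simp add: J_def symp_form_square)
  note assoc = assoc_mult_mat[of _ "2 * g" "2 * g" _ "2 * g" _ "2 * g"]
  have "J * At * J * A = J * (At * J * A)" using A J At by (simp add: assoc)
  also have "\<dots> = - 1\<^sub>m (2 * g)" by (simp add: sym JJ)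
  finally have "B * A = 1\<^sub>m (2 * g)"
    using A J At unfolding B_def by (subst uminus_mult_left_mat) auto
  then have AB: "A * B = 1\<^sub>m (2 * g)"
    by (rule int_mat_mult_left_right_inverse[OF B A])
  have "A * (J * At * J) = - (A * B)"
    using A J At unfolding B_def by (subst uminus_mult_right_mat) auto
  then have *: "A * (J * At * J) = - 1\<^sub>m (2 * g)" by (simp add: AB)
  have "A * (J * At * J) * J = A * J * At * (J * J)" using A J At by (simp add: assoc)
  also have "\<dots> = - (A * J * At)"
    unfolding JJ using A J At by (subst uminus_mult_right_mat) auto
  finally have "- (A * J * At) = - 1\<^sub>m (2 * g) * J" by (simp only: *)
  also have "\<dots> = - J" using J by (subst uminus_mult_left_mat) auto
  finally have "- (A * J * At) = - J" .
  then have AJA: "A * J * At = J" by (metis uminus_uminus_mat)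
  have "transpose_mat B * At = 1\<^sub>m (2 * g)"
    using transpose_mult[OF A B] AB by (simp add: At_def)
  moreover have "transpose_mat B * (At * J * A) * B = transpose_mat B * At * J * (A * B)"
    using A J At B by (simp add: assoc)
  ultimately have "transpose_mat B * (At * J * A) * B = 1\<^sub>m (2 * g) * J * (A * B)"
    by (simp only:)
  then have "transpose_mat B * J * B = J"
    using J by (simp add: sym AB)
  then have "B \<in> Sp g" using B by (simp add: Sp_def J_def)
  then show ?thesis using AB AJA by (auto simp: J_def At_def)
qed

section \<open>Invariance of \<open>\<omega>\<close> and of its divided powers\<close>

lemma omega_ext_deg: "omega g \<in> ext_deg g 2"
  unfolding omega_eq by (intro ext_deg_sum) (auto simp: ext_deg_frag_of)

text \<open>Twice \<open>\<omega>\<close>, so that the sum runs over all pairs and transforms under \<open>A\<close> by \<open>A J A\<^sup>T\<close>.\<close>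

lemma omega_symp_form:
  "frag_cmul 2 (omega g) =
    (\<Sum>a<2 * g. \<Sum>b<2 * g. frag_cmul (symp_form g $$ (a, b)) (frag_of {a} \<^bold>\<and> frag_of {b}))"
proof -
  let ?w = "\<lambda>a b. frag_of {a} \<^bold>\<and> frag_of {b}"
  have row: "(\<Sum>b<2 * g. frag_cmul (symp_form g $$ (2 * j, b)) (?w (2 * j) b)) = ?w (2 * j) (2 * j + 1)"
    "(\<Sum>b<2 * g. frag_cmul (symp_form g $$ (2 * j + 1, b)) (?w (2 * j + 1) b)) = ?w (2 * j) (2 * j + 1)"
    if "j < g" for j
  proof -
    have "(\<Sum>b<2 * g. frag_cmul (symp_form g $$ (2 * j, b)) (?w (2 * j) b)) =
        (\<Sum>b<2 * g. if b = 2 * j + 1 then ?w (2 * j) b else 0)"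
      using that by (intro sum.cong refl) (auto simp: symp_form_def)
    then show "(\<Sum>b<2 * g. frag_cmul (symp_form g $$ (2 * j, b)) (?w (2 * j) b)) = ?w (2 * j) (2 * j + 1)"
      using that by simp
    have "(\<Sum>b<2 * g. frag_cmul (symp_form g $$ (2 * j + 1, b)) (?w (2 * j + 1) b)) =
        (\<Sum>b<2 * g. if b = 2 * j then - ?w (2 * j + 1) b else 0)"
      using that by (intro sum.cong refl) (auto simp: symp_form_def)
    also have "\<dots> = - ?w (2 * j + 1) (2 * j)" using that by simp
    also have "\<dots> = ?w (2 * j) (2 * j + 1)"
      using that ext_deg_1_anticommute[of "frag_of {2 * j}" g "frag_of {2 * j + 1}"]
      by (simp add: ext_deg_frag_of del: wedge_frag_of)
    finally show "(\<Sum>b<2 * g. frag_cmul (symp_form g $$ (2 * j + 1, b)) (?w (2 * j + 1) b)) = ?w (2 * j) (2 * j + 1)" .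
  qed
  have two: "frag_cmul 2 x = x + x" for x :: ext
    using frag_cmul_distrib[of 1 1 x] by simp
  have "(\<Sum>a<2 * g. \<Sum>b<2 * g. frag_cmul (symp_form g $$ (a, b)) (?w a b)) =
      (\<Sum>j<g. ?w (2 * j) (2 * j + 1) + ?w (2 * j) (2 * j + 1))"
    by (subst sum_lessThan_double, rule sum.cong) (simp_all only: row lessThan_iff)
  also have "\<dots> = frag_cmul 2 (omega g)"
    by (simp add: omega_def frag_cmul_sum two del: wedge_frag_of)
  finally show ?thesis by simp
qed

text \<open>In the expansion \<open>omega_symp_form\<close> the action replaces the coefficient
  matrix \<open>J\<close> by \<open>A J A\<^sup>T\<close>, which is again \<open>J\<close>. The
  factor 2 is cancelled at the end.\<close>

lemma ext_act_omega:
  assumes "A \<in> Sp g"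
  shows "ext_act A (omega g) = omega g"
proof -
  let ?J = "symp_form g" and ?w = "\<lambda>a b. frag_of {a} \<^bold>\<and> frag_of {b} :: ext"
  have A: "A \<in> carrier_mat (2 * g) (2 * g)" using assms by (simp add: Sp_def)
  then have dims: "dim_row A = 2 * g" "dim_col A = 2 * g" by auto
  have AJA: "A * ?J * transpose_mat A = ?J" using Sp_inverse[OF assms] by blast
  have entry: "(\<Sum>a<2 * g. \<Sum>b<2 * g. A $$ (c, a) * ?J $$ (a, b) * A $$ (d, b)) = ?J $$ (c, d)"
    if "c < 2 * g" "d < 2 * g" for c d
  proof -
    have "?J $$ (c, d) = (A * ?J * transpose_mat A) $$ (c, d)" by (simp only: AJA)
    also have "\<dots> = (\<Sum>a<2 * g. A $$ (c, a) * (\<Sum>b<2 * g. ?J $$ (a, b) * A $$ (d, b)))"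
      using that A symp_form_carrier[of g] by (simp add: scalar_prod_def lessThan_atLeast0)
    also have "\<dots> = (\<Sum>a<2 * g. \<Sum>b<2 * g. A $$ (c, a) * ?J $$ (a, b) * A $$ (d, b))"
      by (simp add: sum_distrib_left mult.assoc)
    finally show ?thesis by simp
  qed
  have w: "ext_act A (?w a b) = (\<Sum>c<2 * g. \<Sum>d<2 * g. frag_cmul (A $$ (c, a) * A $$ (d, b)) (?w c d))"
    if "a < 2 * g" "b < 2 * g" for a b
  proof -
    have "ext_act A (?w a b) = mat_col_ext A a \<^bold>\<and> mat_col_ext A b"
      using ext_act_wedge_singleton[of "{b}" A g a] dims by (simp add: ext_act_singleton del: wedge_frag_of)
    then show ?thesis
      by (subst sum.swap) (simp add: mat_col_ext_def dims sum_fun_wedge wedge_sum_fun wedge_cmul_left wedge_cmul_right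
          frag_cmul_sum mult.commute del: wedge_frag_of)
  qed
  have "frag_cmul 2 (ext_act A (omega g)) =
      (\<Sum>a<2 * g. \<Sum>b<2 * g. \<Sum>c<2 * g. \<Sum>d<2 * g. frag_cmul (A $$ (c, a) * ?J $$ (a, b) * A $$ (d, b)) (?w c d))"
    unfolding ext_act_cmul[symmetric] omega_symp_form ext_act_sum
    by (intro sum.cong refl) (simp add: ext_act_cmul w frag_cmul_sum mult_ac del: wedge_frag_of)
  \<comment> \<open>The interchanges bring \<open>a\<close> and \<open>b\<close> innermost, where
    \<open>entry\<close> evaluates their sum.\<close>
  also have "\<dots> = (\<Sum>a<2 * g. \<Sum>c<2 * g. \<Sum>b<2 * g. \<Sum>d<2 * g. frag_cmul (A $$ (c, a) * ?J $$ (a, b) * A $$ (d, b)) (?w c d))"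
    by (intro sum.cong refl sum.swap)
  also have "\<dots> = (\<Sum>c<2 * g. \<Sum>a<2 * g. \<Sum>b<2 * g. \<Sum>d<2 * g. frag_cmul (A $$ (c, a) * ?J $$ (a, b) * A $$ (d, b)) (?w c d))"
    by (rule sum.swap)
  also have "\<dots> = (\<Sum>c<2 * g. \<Sum>a<2 * g. \<Sum>d<2 * g. \<Sum>b<2 * g. frag_cmul (A $$ (c, a) * ?J $$ (a, b) * A $$ (d, b)) (?w c d))"
    by (intro sum.cong refl sum.swap)
  also have "\<dots> = (\<Sum>c<2 * g. \<Sum>d<2 * g. \<Sum>a<2 * g. \<Sum>b<2 * g. frag_cmul (A $$ (c, a) * ?J $$ (a, b) * A $$ (d, b)) (?w c d))"
    by (intro sum.cong refl sum.swap)
  also have "\<dots> = frag_cmul 2 (omega g)"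
    unfolding omega_symp_form frag_cmul_sum_left
    by (intro sum.cong refl) (simp add: entry del: wedge_frag_of)
  finally show ?thesis by (simp add: frag_cmul_cancel)
qed

text \<open>Order 1 is multiplicativity together with the invariance of \<open>\<omega>\<close>;
  higher orders follow from \<open>div_pow_Suc\<close> by cancelling \<open>Suc s\<close>.\<close>

lemma ext_act_div_pow:
  assumes "A \<in> Sp g" "x \<in> ext_deg g d"
  shows "ext_act A (div_pow g s x) = div_pow g s (ext_act A x)"
proof -
  have A: "dim_row A = 2 * g" using assms by (auto simp: Sp_def)
  have L: "ext_act A (div_pow g 1 y) = div_pow g 1 (ext_act A y)" if "y \<in> ext_deg g e" for y e
    using ext_act_wedge[OF omega_ext_deg that A] ext_act_omega[OF assms(1)]
    by (simp add: omega_eq_gamma wedge_gamma_left)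
  show ?thesis
  proof (induction s)
    case (Suc s)
    have "frag_cmul (int (Suc s)) (ext_act A (div_pow g (Suc s) x)) = frag_cmul (int (Suc s)) (div_pow g (Suc s) (ext_act A x))"
      by (simp only: ext_act_cmul[symmetric] div_pow_Suc[symmetric] L[OF div_pow_ext_deg[OF assms(2) refl]] Suc)
    then show ?case by (simp add: frag_cmul_cancel del: of_nat_Suc)
  qed simp
qed

section \<open>Quotients and filtrations of modules\<close>

text \<open>
  Surjectivity of the operators makes the image of a coset again a full coset, as the definition of
  \<open>quot_gmod\<close> presumes.
\<close>

locale gmodule = comm_group M for S :: "'s set" and M :: "('a, 's) gmod" (structure) +
  assumes act_hom: "s \<in> S \<Longrightarrow> act M s \<in> hom M M"
    and act_inverse: "s \<in> S \<Longrightarrow> \<exists>s' \<in> S. \<forall>x \<in> carrier M. act M s (act M s' x) = x"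

text \<open>\<open>quot_gmod\<close> and the factor group are records of different types, so the
  group axioms are carried over along equality of the components.\<close>

lemma comm_group_cong:
  assumes "comm_group G" "carrier H = carrier G" "monoid.mult H = monoid.mult G" "\<one>\<^bsub>H\<^esub> = \<one>\<^bsub>G\<^esub>"
  shows "comm_group H"
proof -
  interpret comm_group G by fact
  show ?thesis
    by (rule comm_groupI) (use assms(2-4) l_inv_ex in \<open>auto simp: m_assoc intro: m_comm\<close>)
qed

lemma sub_gmod_simps [simp]:
  "carrier (sub_gmod M N) = N"
  "monoid.mult (sub_gmod M N) = monoid.mult M"
  "\<one>\<^bsub>sub_gmod M N\<^esub> = \<one>\<^bsub>M\<^esub>"
  "act (sub_gmod M N) = act M"
  "r_coset (sub_gmod M N) = r_coset M"
  by (simp_all add: sub_gmod_def r_coset_def fun_eq_iff)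

lemma quot_gmod_simps [simp]:
  "carrier (quot_gmod M N) = r_coset M N ` carrier M"
  "monoid.mult (quot_gmod M N) = set_mult M"
  "\<one>\<^bsub>quot_gmod M N\<^esub> = N"
  "act (quot_gmod M N) s C = act M s ` C"
  by (simp_all add: quot_gmod_def monoid.defs gmod.defs carrier_FactGroup[symmetric] FactGroup_def)

text \<open>Two preimages under \<open>f\<close> differ by an element of its kernel, which
  \<open>h\<close> kills, so the choice of a preimage is harmless. Both the isomorphisms and the
  splittings of the graded pieces come from this.\<close>

lemma hom_lift:
  assumes "group A" "group B" "group C" "f \<in> hom A B" "f ` carrier A = carrier B" "h \<in> hom A C"
    and ker: "\<And>a. a \<in> carrier A \<Longrightarrow> f a = \<one>\<^bsub>B\<^esub> \<Longrightarrow> h a = \<one>\<^bsub>C\<^esub>"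
  obtains \<phi> where "\<phi> \<in> hom B C" "\<And>a. a \<in> carrier A \<Longrightarrow> \<phi> (f a) = h a"
proof -
  interpret f: group_hom A B f using assms by (simp add: group_hom_def group_hom_axioms_def)
  interpret h: group_hom A C h using assms by (simp add: group_hom_def group_hom_axioms_def)
  define \<phi> where "\<phi> = (\<lambda>b. h (SOME a. a \<in> carrier A \<and> f a = b))"
  have \<phi>: "\<phi> (f a) = h a" if a: "a \<in> carrier A" for a
  proof -
    define a' where "a' = (SOME a'. a' \<in> carrier A \<and> f a' = f a)"
    have a': "a' \<in> carrier A" "f a' = f a"
      using someI[of "\<lambda>a'. a' \<in> carrier A \<and> f a' = f a" a] a unfolding a'_def by blast+
    have "f (a' \<otimes>\<^bsub>A\<^esub> inv\<^bsub>A\<^esub> a) = \<one>\<^bsub>B\<^esub>" using a a' by simp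
    then have "h (a' \<otimes>\<^bsub>A\<^esub> inv\<^bsub>A\<^esub> a) = \<one>\<^bsub>C\<^esub>" using ker a a' by simp
    then have "h a' \<otimes>\<^bsub>C\<^esub> inv\<^bsub>C\<^esub> h a = \<one>\<^bsub>C\<^esub>" using a a' by simp
    then have "h a' = h a" using a a' by (simp add: h.H.inv_solve_right')
    then show ?thesis by (simp add: \<phi>_def a'_def)
  qed
  have "\<phi> \<in> hom B C"
  proof (rule homI)
    fix x y assume "x \<in> carrier B" "y \<in> carrier B"
    then obtain a b where ab: "a \<in> carrier A" "b \<in> carrier A" "x = f a" "y = f b"
      using assms(5) by blast
    then show "\<phi> (x \<otimes>\<^bsub>B\<^esub> y) = \<phi> x \<otimes>\<^bsub>C\<^esub> \<phi> y"
      using \<phi>[of "a \<otimes>\<^bsub>A\<^esub> b"] by (simp add: \<phi>)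
  next
    fix x assume "x \<in> carrier B"
    then show "\<phi> x \<in> carrier C" using assms(5) \<phi> h.hom_closed by (metis imageE)
  qed
  then show thesis using \<phi> that by blast
qed

text \<open>The first isomorphism theorem in symmetric form: comparing two equivariant surjections
  from one module avoids writing down a map between the quotients.\<close>

lemma gmod_isomorphic_if_same_kernel:
  assumes "group A" "group B" "group C"
    and f: "f \<in> hom A B" "f ` carrier A = carrier B"
    and h: "h \<in> hom A C" "h ` carrier A = carrier C"
    and ker: "\<And>a. a \<in> carrier A \<Longrightarrow> f a = \<one>\<^bsub>B\<^esub> \<longleftrightarrow> h a = \<one>\<^bsub>C\<^esub>"
    and act: "\<And>s a. s \<in> S \<Longrightarrow> a \<in> carrier A \<Longrightarrow> act A s a \<in> carrier A"
      "\<And>s a. s \<in> S \<Longrightarrow> a \<in> carrier A \<Longrightarrow> act B s (f a) = f (act A s a)"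
      "\<And>s a. s \<in> S \<Longrightarrow> a \<in> carrier A \<Longrightarrow> act C s (h a) = h (act A s a)"
  shows "gmod_isomorphic S B C"
proof -
  obtain \<phi> where \<phi>: "\<phi> \<in> hom B C" "\<And>a. a \<in> carrier A \<Longrightarrow> \<phi> (f a) = h a"
    using hom_lift[OF assms(1-3) f h(1)] ker by metis
  interpret \<phi>: group_hom B C \<phi> using assms \<phi> by (simp add: group_hom_def group_hom_axioms_def)
  have "\<phi> \<in> iso B C"
    unfolding \<phi>.iso_iff
  proof (intro conjI subsetI ballI impI)
    fix y assume "y \<in> carrier C"
    then obtain a where a: "a \<in> carrier A" "y = h a" using h(2) by blast
    then have "y = \<phi> (f a)" "f a \<in> carrier B" using \<phi>(2) f(2) by auto
    then show "y \<in> \<phi> ` carrier B" by blast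
  next
    fix x assume "x \<in> carrier B" "\<phi> x = \<one>\<^bsub>C\<^esub>"
    moreover from this obtain a where "a \<in> carrier A" "x = f a" using f(2) by blast
    ultimately show "x = \<one>\<^bsub>B\<^esub>" using ker \<phi>(2) by simp
  qed
  moreover have "\<phi> (act B s x) = act C s (\<phi> x)" if s: "s \<in> S" and x: "x \<in> carrier B" for s x
  proof -
    obtain a where a: "a \<in> carrier A" "x = f a" using x f(2) by blast
    then have "\<phi> (act B s x) = h (act A s a)" using act(1,2) s \<phi>(2) by simp
    also have "\<dots> = act C s (\<phi> x)" using act(3) s \<phi>(2) a by simp
    finally show ?thesis .
  qed
  ultimately show ?thesis unfolding gmod_isomorphic_def by blast
qed

context gmodule
begin

lemma act_closed: "s \<in> S \<Longrightarrow> x \<in> carrier M \<Longrightarrow> act M s x \<in> carrier M"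
  by (rule hom_in_carrier[OF act_hom])

lemma sub_gmodule:
  assumes "subgmod S N M"
  shows "gmodule S (sub_gmod M N)"
proof -
  have N: "subgroup N M" and N_act: "\<And>s x. s \<in> S \<Longrightarrow> x \<in> N \<Longrightarrow> act M s x \<in> N"
    using assms by (auto simp: subgmod_def)
  have sub: "N \<subseteq> carrier M" by (rule subgroup.subset[OF N])
  have "comm_group (M\<lparr>carrier := N\<rparr>)"
    by (rule group.group_comm_groupI[OF subgroup_imp_group[OF N]])
       (simp, rule m_comm; use sub in blast)
  then interpret N: comm_group "sub_gmod M N" by (simp add: sub_gmod_def)
  show ?thesis
  proof
    fix s assume s: "s \<in> S"
    show "act (sub_gmod M N) s \<in> hom (sub_gmod M N) (sub_gmod M N)"
      by (rule homI) (use N_act[OF s] hom_mult[OF act_hom[OF s]] sub in auto)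
    show "\<exists>s'\<in>S. \<forall>x\<in>carrier (sub_gmod M N). act (sub_gmod M N) s (act (sub_gmod M N) s' x) = x"
      using act_inverse[OF s] sub by auto
  qed
qed

lemma
  assumes "subgmod S N M"
  shows r_coset_hom: "r_coset M N \<in> hom M (quot_gmod M N)"
    and r_coset_eq_one_iff: "x \<in> carrier M \<Longrightarrow> N #> x = \<one>\<^bsub>quot_gmod M N\<^esub> \<longleftrightarrow> x \<in> N"
    and act_r_coset: "s \<in> S \<Longrightarrow> x \<in> carrier M \<Longrightarrow> act (quot_gmod M N) s (N #> x) = N #> act M s x"
    and quot_gmodule: "gmodule S (quot_gmod M N)"
proof -
  have N: "subgroup N M" and N_act: "\<And>s x. s \<in> S \<Longrightarrow> x \<in> N \<Longrightarrow> act M s x \<in> N"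
    using assms by (auto simp: subgmod_def)
  have sub: "N \<subseteq> carrier M" by (rule subgroup.subset[OF N])
  interpret N: normal N M using N by (rule subgroup_imp_normal)
  show hom: "r_coset M N \<in> hom M (quot_gmod M N)"
    by (rule homI) (simp_all add: N.rcos_sum)
  show "N #> x = \<one>\<^bsub>quot_gmod M N\<^esub> \<longleftrightarrow> x \<in> N" if "x \<in> carrier M" for x
    using that coset_join1[OF _ that N] coset_join2[OF that N] by auto
  show act: "act (quot_gmod M N) s (N #> x) = N #> act M s x" if s: "s \<in> S" and x: "x \<in> carrier M" for s x
  proof -
    have mult: "act M s (n \<otimes> x) = act M s n \<otimes> act M s x" if "n \<in> N" for n
      using hom_mult[OF act_hom[OF s]] that x sub by blast
    \<comment> \<open>For the inclusion from right to left, \<open>act M s' n\<close> is a preimage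
      of \<open>n\<close>; it stays in \<open>N\<close> because \<open>N\<close> is stable under all
      of \<open>S\<close>.\<close>
    have "act M s ` N = N"
    proof
      show "act M s ` N \<subseteq> N" using N_act[OF s] by blast
      show "N \<subseteq> act M s ` N"
      proof
        fix n assume n: "n \<in> N"
        obtain s' where "s' \<in> S" "\<forall>x\<in>carrier M. act M s (act M s' x) = x" using act_inverse[OF s] by blast
        then have "act M s' n \<in> N" "act M s (act M s' n) = n" using n N_act sub by auto
        then show "n \<in> act M s ` N" by (metis imageI)
      qed
    qed
    then have "(\<Union>n\<in>N. {n \<otimes> act M s x}) = (\<Union>n\<in>act M s ` N. {n \<otimes> act M s x})"
      by (rule arg_cong[OF sym])
    also have "\<dots> = act M s ` (N #> x)"
      by (simp add: r_coset_def image_UN mult)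
    finally show ?thesis by (simp add: r_coset_def)
  qed
  interpret Q: comm_group "quot_gmod M N"
    by (rule comm_group_cong[OF abelian_FactGroup[OF N]]) (simp_all add: carrier_FactGroup)
  show "gmodule S (quot_gmod M N)"
  proof
    fix s assume s: "s \<in> S"
    show "act (quot_gmod M N) s \<in> hom (quot_gmod M N) (quot_gmod M N)"
    proof (rule homI)
      fix C assume "C \<in> carrier (quot_gmod M N)"
      then obtain x where "x \<in> carrier M" "C = N #> x" by auto
      then show "act (quot_gmod M N) s C \<in> carrier (quot_gmod M N)"
        using act[OF s] act_closed[OF s] by (simp del: quot_gmod_simps(4))
    next
      fix C D assume "C \<in> carrier (quot_gmod M N)" "D \<in> carrier (quot_gmod M N)"
      then obtain x y where xy: "x \<in> carrier M" "C = N #> x" "y \<in> carrier M" "D = N #> y" by auto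
      note m = hom_mult[OF hom]
      have "C \<otimes>\<^bsub>quot_gmod M N\<^esub> D = N #> (x \<otimes> y)" using xy m by metis
      then have "act (quot_gmod M N) s (C \<otimes>\<^bsub>quot_gmod M N\<^esub> D) = N #> act M s (x \<otimes> y)"
        using act[OF s] xy by (metis m_closed)
      also have "\<dots> = N #> (act M s x \<otimes> act M s y)" using hom_mult[OF act_hom[OF s]] xy by simp
      also have "\<dots> = (N #> act M s x) \<otimes>\<^bsub>quot_gmod M N\<^esub> (N #> act M s y)"
        using m act_closed[OF s] xy by metis
      finally show "act (quot_gmod M N) s (C \<otimes>\<^bsub>quot_gmod M N\<^esub> D) =
          act (quot_gmod M N) s C \<otimes>\<^bsub>quot_gmod M N\<^esub> act (quot_gmod M N) s D"
        using act[OF s] xy by metis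
    qed
    obtain s' where s': "s' \<in> S" "\<forall>x\<in>carrier M. act M s (act M s' x) = x" using act_inverse[OF s] by blast
    have "act (quot_gmod M N) s (act (quot_gmod M N) s' C) = C" if C: "C \<in> carrier (quot_gmod M N)" for C
    proof -
      obtain x where "x \<in> carrier M" "C = N #> x" using C by auto
      then show ?thesis using act s s' act_closed by metis
    qed
    then show "\<exists>s'\<in>S. \<forall>C\<in>carrier (quot_gmod M N). act (quot_gmod M N) s (act (quot_gmod M N) s' C) = C"
      using s'(1) by blast
  qed
qed

lemma subgmod_subset: "subgmod S N M \<Longrightarrow> N \<subseteq> carrier M"
  by (auto simp: subgmod_def dest: subgroup.subset)

lemma subgmod_image_r_coset:
  assumes "subgmod S I M" "subgmod S N M"
  shows "subgmod S (r_coset M I ` N) (quot_gmod M I)"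
proof -
  interpret Q: gmodule S "quot_gmod M I" by (rule quot_gmodule[OF assms(1)])
  interpret \<rho>: group_hom M "quot_gmod M I" "r_coset M I"
    by (simp add: group_hom_def group_hom_axioms_def r_coset_hom[OF assms(1)] is_group Q.is_group)
  have "subgroup (r_coset M I ` N) (quot_gmod M I)"
    using assms(2) by (intro \<rho>.subgroup_img_is_subgroup) (simp add: subgmod_def)
  moreover have "act (quot_gmod M I) s C \<in> r_coset M I ` N" if s: "s \<in> S" and C: "C \<in> r_coset M I ` N" for s C
  proof -
    obtain n where n: "n \<in> N" "C = I #> n" using C by blast
    then have "act (quot_gmod M I) s C = I #> act M s n"
      using act_r_coset[OF assms(1) s] subgmod_subset[OF assms(2)] by blast
    moreover have "act M s n \<in> N" using assms(2) n s by (simp add: subgmod_def)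
    ultimately show ?thesis by blast
  qed
  ultimately show ?thesis unfolding subgmod_def by blast
qed

lemma subgmod_sub_gmod:
  assumes "subgmod S N M" "subgmod S N' M" "N' \<subseteq> N"
  shows "subgmod S N' (sub_gmod M N)"
  using assms subgroup_incl[of N' N] by (simp add: subgmod_def sub_gmod_def)

text \<open>Elements of a graded piece of the quotient by \<open>I\<close> are cosets of cosets. The
  map \<open>\<pi>\<close>, a composite of two coset projections, presents the piece by
  representatives in \<open>N\<close> with an explicit kernel.\<close>

lemma gr_projection:
  assumes I: "subgmod S I M" and N: "subgmod S N M" and N': "subgmod S N' M" and "N' \<subseteq> N"
  defines "\<pi> \<equiv> \<lambda>n. r_coset M I ` N' #>\<^bsub>quot_gmod M I\<^esub> (I #> n)"
    and "G \<equiv> quot_gmod (sub_gmod (quot_gmod M I) (r_coset M I ` N)) (r_coset M I ` N')"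
  shows "gmodule S G"
    and "\<pi> \<in> hom (sub_gmod M N) G"
    and "\<pi> ` N = carrier G"
    and "\<And>n. n \<in> N \<Longrightarrow> \<pi> n = \<one>\<^bsub>G\<^esub> \<longleftrightarrow> (\<exists>k \<in> I. \<exists>n' \<in> N'. n = k \<otimes> n')"
    and "\<And>s n. s \<in> S \<Longrightarrow> n \<in> N \<Longrightarrow> act G s (\<pi> n) = \<pi> (act M s n)"
proof -
  let ?Q = "quot_gmod M I" and ?\<rho> = "r_coset M I"
  interpret Q: gmodule S ?Q by (rule quot_gmodule[OF I])
  note \<rho> = r_coset_hom[OF I]
  note F = subgmod_image_r_coset[OF I N] and F' = subgmod_image_r_coset[OF I N']
  interpret F: gmodule S "sub_gmod ?Q (?\<rho> ` N)" by (rule Q.sub_gmodule[OF F])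
  have F'F: "subgmod S (?\<rho> ` N') (sub_gmod ?Q (?\<rho> ` N))"
    by (rule Q.subgmod_sub_gmod[OF F F']) (use \<open>N' \<subseteq> N\<close> in blast)
  note N_sub = subgmod_subset[OF N]
  show "gmodule S G" unfolding G_def by (rule F.quot_gmodule[OF F'F])
  note \<pi>0 = F.r_coset_hom[OF F'F, folded G_def, unfolded sub_gmod_simps]
  have mult: "\<pi> (m \<otimes> n) = \<pi> m \<otimes>\<^bsub>G\<^esub> \<pi> n" if "m \<in> N" "n \<in> N" for m n
    using hom_mult[OF \<rho>, of m n] hom_mult[OF \<pi>0, of "I #> m" "I #> n"] that N_sub
    by (simp add: \<pi>_def subset_iff)
  show \<pi>_carrier: "\<pi> ` N = carrier G"
    by (simp add: \<pi>_def G_def image_image)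
  then show "\<pi> \<in> hom (sub_gmod M N) G"
    by (intro homI) (auto simp: mult)
  show "\<pi> n = \<one>\<^bsub>G\<^esub> \<longleftrightarrow> (\<exists>k \<in> I. \<exists>n' \<in> N'. n = k \<otimes> n')" if n: "n \<in> N" for n
  proof -
    have I': "subgroup I M" using I by (simp add: subgmod_def)
    have "\<pi> n = \<one>\<^bsub>G\<^esub> \<longleftrightarrow> I #> n \<in> ?\<rho> ` N'"
      using F.r_coset_eq_one_iff[OF F'F, of "I #> n"] n by (simp add: \<pi>_def G_def)
    also have "\<dots> \<longleftrightarrow> (\<exists>n'\<in>N'. n \<in> I #> n')"
    proof -
      have "I #> n = I #> n' \<longleftrightarrow> n \<in> I #> n'" if "n' \<in> N'" for n'
      proof
        assume "I #> n = I #> n'"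
        then show "n \<in> I #> n'" using rcos_self[OF _ I', of n] n N_sub by blast
      next
        assume "n \<in> I #> n'"
        then show "I #> n = I #> n'" using repr_independence[OF _ _ I'] that subgmod_subset[OF N'] by blast
      qed
      then show ?thesis by blast
    qed
    also have "\<dots> \<longleftrightarrow> (\<exists>k \<in> I. \<exists>n' \<in> N'. n = k \<otimes> n')"
      by (auto simp: r_coset_def)
    finally show ?thesis .
  qed
  show "act G s (\<pi> n) = \<pi> (act M s n)" if "s \<in> S" "n \<in> N" for s n
  proof -
    have "act G s (\<pi> n) = ?\<rho> ` N' #>\<^bsub>?Q\<^esub> act ?Q s (I #> n)"
      using F.act_r_coset[OF F'F that(1), of "I #> n"] that(2)
      by (simp add: \<pi>_def G_def del: quot_gmod_simps(4))
    then show ?thesis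
      using act_r_coset[OF I that(1)] that(2) N_sub by (simp add: \<pi>_def subset_iff del: quot_gmod_simps(4))
  qed
qed

end

section \<open>The filtration of the cokernel\<close>

lemma ext_power_simps [simp]:
  "carrier (ext_power g k) = ext_deg g (int k)"
  "x \<otimes>\<^bsub>ext_power g k\<^esub> y = x + y"
  "\<one>\<^bsub>ext_power g k\<^esub> = 0"
  "act (ext_power g k) = ext_act"
  by (auto simp: ext_power_def monoid.defs gmod.defs free_Abelian_group_def ext_deg_def)

lemma gmodule_ext_power: "gmodule (Sp g) (ext_power g k)"
proof -
  interpret comm_group "ext_power g k"
  proof (rule comm_groupI)
    fix x assume "x \<in> carrier (ext_power g k)"
    then show "\<exists>y\<in>carrier (ext_power g k). y \<otimes>\<^bsub>ext_power g k\<^esub> x = \<one>\<^bsub>ext_power g k\<^esub>"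
      by (intro bexI[of _ "- x"]) (simp_all add: ext_deg_minus)
  qed (simp_all add: ext_deg_add add_ac)
  show ?thesis
  proof
    fix A assume A: "A \<in> Sp g"
    then have dim: "A \<in> carrier_mat (2 * g) (2 * g)" by (simp add: Sp_def)
    then show "act (ext_power g k) A \<in> hom (ext_power g k) (ext_power g k)"
      by (intro homI) (simp_all add: ext_act_ext_deg ext_act_add)
    obtain B where "B \<in> Sp g" "A * B = 1\<^sub>m (2 * g)" using Sp_inverse[OF A] by blast
    moreover from this have "B \<in> carrier_mat (2 * g) (2 * g)" by (simp add: Sp_def)
    ultimately show "\<exists>B\<in>Sp g. \<forall>x\<in>carrier (ext_power g k). act (ext_power g k) A (act (ext_power g k) B x) = x"
      using ext_act_mult[OF dim] ext_act_one by (intro bexI[of _ B]) simp_all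
  qed
qed

lemma subgmod_ext_powerI:
  assumes "N \<subseteq> ext_deg g (int k)" "0 \<in> N" "\<And>x y. x \<in> N \<Longrightarrow> y \<in> N \<Longrightarrow> x + y \<in> N" "\<And>x. x \<in> N \<Longrightarrow> - x \<in> N"
    "\<And>A x. A \<in> Sp g \<Longrightarrow> x \<in> N \<Longrightarrow> ext_act A x \<in> N"
  shows "subgmod (Sp g) N (ext_power g k)"
proof -
  interpret gmodule "Sp g" "ext_power g k" by (rule gmodule_ext_power)
  have "inv\<^bsub>ext_power g k\<^esub> x = - x" if "x \<in> N" for x
    by (rule inv_equality) (use that assms(1) in \<open>auto simp: ext_deg_minus\<close>)
  then show ?thesis
    unfolding subgmod_def using assms by (auto intro!: subgroup.intro)
qed

lemma Sp_dim_row: "A \<in> Sp g \<Longrightarrow> dim_row A = 2 * g"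
  by (auto simp: Sp_def)

lemma subgmod_ker_div_pow: "subgmod (Sp g) {x \<in> ext_deg g (int k). div_pow g s x = 0} (ext_power g k)"
  by (rule subgmod_ext_powerI)
     (auto simp: ext_deg_add ext_deg_minus div_pow_add div_pow_minus ext_act_ext_deg[OF _ Sp_dim_row] ext_act_div_pow[symmetric])

lemma subgmod_image_div_pow:
  assumes "int k = d + 2 * int s"
  shows "subgmod (Sp g) (div_pow g s ` ext_deg g d) (ext_power g k)"
proof (rule subgmod_ext_powerI)
  show "div_pow g s ` ext_deg g d \<subseteq> ext_deg g (int k)" using div_pow_ext_deg assms by blast
  show "0 \<in> div_pow g s ` ext_deg g d" by (rule image_eqI[of _ _ 0]) simp_all
  show "x + y \<in> div_pow g s ` ext_deg g d" if "x \<in> div_pow g s ` ext_deg g d" "y \<in> div_pow g s ` ext_deg g d" for x y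
    using that ext_deg_add by (auto simp: div_pow_add[symmetric])
  show "- x \<in> div_pow g s ` ext_deg g d" if "x \<in> div_pow g s ` ext_deg g d" for x
    using that ext_deg_minus by (auto simp: div_pow_minus[symmetric])
  show "ext_act A x \<in> div_pow g s ` ext_deg g d" if "A \<in> Sp g" "x \<in> div_pow g s ` ext_deg g d" for A x
    using that ext_act_ext_deg[OF _ Sp_dim_row] by (auto simp: ext_act_div_pow)
qed

definition primitives :: "nat \<Rightarrow> nat \<Rightarrow> ext set" where
  "primitives g k = {x \<in> ext_deg g (int k). div_pow g (g - k + 1) x = 0}"

text \<open>\<open>\<omega>\<^sup>s \<and> x\<close> is \<open>s!\<close> times
  \<open>L\<^sub>s x\<close>; without torsion, the power and the divided power have the same
  kernel.\<close>

lemma primitive_eq: "primitive g k = sub_gmod (ext_power g k) (primitives g k)"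
  by (simp add: primitive_def primitives_def wedge_pow_wedge del: wedge_pow.simps)

lemma gmodule_primitive: "gmodule (Sp g) (primitive g k)"
  unfolding primitive_eq
  by (rule gmodule.sub_gmodule[OF gmodule_ext_power]) (simp add: primitives_def subgmod_ker_div_pow)

lemma primitive_simps [simp]:
  "carrier (primitive g k) = primitives g k"
  "x \<otimes>\<^bsub>primitive g k\<^esub> y = x + y"
  "\<one>\<^bsub>primitive g k\<^esub> = 0"
  "act (primitive g k) = ext_act"
  "x [^]\<^bsub>primitive g k\<^esub> (n :: nat) = frag_cmul (int n) x"
proof -
  show "x [^]\<^bsub>primitive g k\<^esub> (n :: nat) = frag_cmul (int n) x"
    by (induction n) (simp_all add: primitive_eq nat_pow_def frag_cmul_distrib add.commute)
qed (simp_all add: primitive_eq)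

lemma subgmod_multiples: "subgmod (Sp g) ((\<lambda>x. frag_cmul c x) ` primitives g k) (primitive g k)"
proof -
  have P: "subgmod (Sp g) (primitives g k) (ext_power g k)"
    unfolding primitives_def by (rule subgmod_ker_div_pow)
  have P_add: "x + y \<in> primitives g k" and P_minus: "- x \<in> primitives g k"
    and P_cmul: "frag_cmul c x \<in> primitives g k" and P_act: "A \<in> Sp g \<Longrightarrow> ext_act A x \<in> primitives g k"
    if "x \<in> primitives g k" "y \<in> primitives g k" for x y A
    using that P
    by (auto simp: primitives_def subgmod_def ext_deg_add ext_deg_minus ext_deg_cmul div_pow_add div_pow_minus div_pow_cmul)
  have "subgmod (Sp g) ((\<lambda>x. frag_cmul c x) ` primitives g k) (ext_power g k)"
  proof (rule subgmod_ext_powerI)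
    show "(\<lambda>x. frag_cmul c x) ` primitives g k \<subseteq> ext_deg g (int k)"
      by (auto simp: primitives_def ext_deg_cmul)
    show "0 \<in> (\<lambda>x. frag_cmul c x) ` primitives g k"
      by (rule image_eqI[of _ _ 0]) (simp_all add: primitives_def)
    fix x assume "x \<in> (\<lambda>x. frag_cmul c x) ` primitives g k"
    then obtain p where p: "p \<in> primitives g k" "x = frag_cmul c p" by blast
    have "- x = frag_cmul c (- p)" using p by (metis additive.minus additive_def frag_cmul_distrib2)
    then show "- x \<in> (\<lambda>x. frag_cmul c x) ` primitives g k" using P_minus[OF p(1) p(1)] by blast
    show "ext_act A x \<in> (\<lambda>x. frag_cmul c x) ` primitives g k" if "A \<in> Sp g" for A
      using P_act[OF p(1) p(1) that] p by (simp add: ext_act_cmul)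
    fix y assume "y \<in> (\<lambda>x. frag_cmul c x) ` primitives g k"
    then obtain q where q: "q \<in> primitives g k" "y = frag_cmul c q" by blast
    show "x + y \<in> (\<lambda>x. frag_cmul c x) ` primitives g k"
      using P_add[OF p(1) q(1)] p q by (metis frag_cmul_distrib2 imageI)
  qed
  then show ?thesis
    unfolding primitive_eq
    by (rule gmodule.subgmod_sub_gmod[OF gmodule_ext_power P]) (use P_cmul in blast)
qed

section \<open>The filtration by kernels of divided powers\<close>

definition omega_image :: "nat \<Rightarrow> nat \<Rightarrow> ext set" where
  "omega_image g i = div_pow g i ` ext_deg g (int g - int i)"

lemma coker_omega_eq:
  assumes "i \<le> g"
  shows "coker_omega g i = quot_gmod (ext_power g (g + i)) (omega_image g i)"
proof -
  have "(\<lambda>x. x \<^bold>\<and> omega_div_pow g i) ` carrier (ext_power g (g - i)) = omega_image g i"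
    unfolding omega_image_def using assms
    by (auto simp: omega_div_pow_eq wedge_gamma_right[OF ext_deg_finite] of_nat_diff intro!: image_cong)
  then show ?thesis by (simp add: coker_omega_def)
qed

text \<open>The filtration before passage to the cokernel. For \<open>r \<le> - 1\<close> the
  truncation by \<open>nat\<close> gives the kernel of \<open>L\<^sub>0\<close>, the identity, hence
  zero.\<close>

definition ker_filtration :: "nat \<Rightarrow> nat \<Rightarrow> int \<Rightarrow> ext set" where
  "ker_filtration g i r = {x \<in> ext_deg g (int (g + i)). div_pow g (nat (r + 1)) x = 0}"

lemma subgmod_ker_filtration: "subgmod (Sp g) (ker_filtration g i r) (ext_power g (g + i))"
  unfolding ker_filtration_def by (rule subgmod_ker_div_pow)

lemma subgmod_omega_image: "subgmod (Sp g) (omega_image g i) (ext_power g (g + i))"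
  unfolding omega_image_def by (rule subgmod_image_div_pow) simp

lemma ker_filtration_mono: "r \<le> r' \<Longrightarrow> ker_filtration g i r \<subseteq> ker_filtration g i r'"
  unfolding ker_filtration_def using div_pow_eq_0_mono[of g "nat (r + 1)" _ "nat (r' + 1)"] by auto

lemma ker_filtration_neg: "r < 0 \<Longrightarrow> ker_filtration g i r = {0}"
  by (auto simp: ker_filtration_def)

text \<open>\<open>L\<^sub>r\<^sub>+\<^sub>1\<close> lands in degree
  \<open>g + i + 2 (r + 1)\<close>, which exceeds the top degree \<open>2 g\<close> for these
  \<open>r\<close>.\<close>

lemma ker_filtration_top:
  assumes "i \<le> g" "r \<ge> int ((g - i) div 2)"
  shows "ker_filtration g i r = ext_deg g (int (g + i))"
proof -
  have "div_pow g (nat (r + 1)) x = 0" if "x \<in> ext_deg g (int (g + i))" for x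
    by (rule ext_deg_empty[OF div_pow_ext_deg[OF that refl]]) (use assms in linarith)
  then show ?thesis by (auto simp: ker_filtration_def)
qed

text \<open>\<open>L L\<^sub>r\<close> is a multiple of \<open>L\<^sub>r\<^sub>+\<^sub>1\<close>;
  hence \<open>L\<^sub>r\<close> maps step \<open>r\<close> of the filtration into the group
  \<open>Q\<close>.\<close>

lemma div_pow_ker_filtration:
  assumes "x \<in> ker_filtration g i (int r)"
  shows "div_pow g r x \<in> ext_deg g (int g + int i + 2 * int r)" "div_pow g 1 (div_pow g r x) = 0"
proof -
  have x: "x \<in> ext_deg g (int g + int i)" "div_pow g (Suc r) x = 0"
    using assms by (simp_all add: ker_filtration_def nat_add_distrib)
  show "div_pow g r x \<in> ext_deg g (int g + int i + 2 * int r)" by (rule div_pow_ext_deg[OF x(1) refl])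
  show "div_pow g 1 (div_pow g r x) = 0" by (simp add: div_pow_Suc x(2) del: of_nat_Suc One_nat_def)
qed

text \<open>Consequently \<open>L\<^sub>r\<close> embeds the quotient of consecutive steps into
  \<open>Q\<close>.\<close>

lemma ker_filtration_pred: "ker_filtration g i (int r - 1) = {x \<in> ker_filtration g i (int r). div_pow g r x = 0}"
  using ker_filtration_mono[of "int r - 1" "int r" g i] by (auto simp: ker_filtration_def)

text \<open>
  The left-hand side is the kernel of the projection to \<open>gr\<^sub>r\<close>, see \<open>gr_class\<close> below.
\<close>

lemma ker_filtration_kernel:
  assumes "additive \<tau>" "\<And>q. q \<in> ext_deg g (int g + int i + 2 * int r) \<Longrightarrow> div_pow g 1 q = 0 \<Longrightarrow>
      div_pow g r (\<tau> q) = q \<and> \<tau> q \<in> ext_deg g (int g + int i) \<and>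
      (\<exists>z \<in> ext_deg g (int g - int i). div_pow g i z = frag_cmul (int ((r + i) choose i)) (\<tau> q))"
    and n: "n \<in> ker_filtration g i (int r)"
  shows "(\<exists>k \<in> omega_image g i. \<exists>n' \<in> ker_filtration g i (int r - 1). n = k + n') \<longleftrightarrow>
    (\<exists>q \<in> ext_deg g (int g + int i + 2 * int r). div_pow g 1 q = 0 \<and>
       div_pow g r n = frag_cmul (int ((r + i) choose i)) q)"
proof
  assume "\<exists>k \<in> omega_image g i. \<exists>n' \<in> ker_filtration g i (int r - 1). n = k + n'"
  then obtain z n' where z: "z \<in> ext_deg g (int g - int i)" and n': "div_pow g r n' = 0" "n = div_pow g i z + n'"
    unfolding omega_image_def ker_filtration_pred by blast
  \<comment> \<open>\<open>L\<^sub>r L\<^sub>i\<close> is the binomial multiple of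
    \<open>L\<^sub>r\<^sub>+\<^sub>i\<close>, and \<open>L\<^sub>r\<close> kills \<open>n'\<close>;
    so \<open>q\<close> is what remains of \<open>L\<^sub>r n\<close> after division by the binomial
    coefficient.\<close>
  define q where "q = div_pow g (r + i) z"
  have eq: "div_pow g r n = frag_cmul (int ((r + i) choose i)) q"
    using n' binomial_symmetric[of i "r + i"] by (simp add: div_pow_add div_pow_mult q_def)
  have "frag_cmul (int ((r + i) choose i)) (div_pow g 1 q) = 0"
    using div_pow_ker_filtration(2)[OF n] by (simp only: eq div_pow_cmul)
  then have "div_pow g 1 q = 0" by simp
  moreover have "q \<in> ext_deg g (int g + int i + 2 * int r)"
    unfolding q_def by (rule div_pow_ext_deg[OF z]) simp
  ultimately show "\<exists>q \<in> ext_deg g (int g + int i + 2 * int r). div_pow g 1 q = 0 \<and>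
       div_pow g r n = frag_cmul (int ((r + i) choose i)) q" using eq by blast
next
  assume "\<exists>q \<in> ext_deg g (int g + int i + 2 * int r). div_pow g 1 q = 0 \<and>
       div_pow g r n = frag_cmul (int ((r + i) choose i)) q"
  then obtain q where q: "q \<in> ext_deg g (int g + int i + 2 * int r)" "div_pow g 1 q = 0"
    "div_pow g r n = frag_cmul (int ((r + i) choose i)) q" by blast
  obtain z where z: "z \<in> ext_deg g (int g - int i)" "div_pow g i z = frag_cmul (int ((r + i) choose i)) (\<tau> q)"
    and \<tau>: "div_pow g r (\<tau> q) = q"
    using assms(2)[OF q(1,2)] by blast
  \<comment> \<open>Since \<open>L\<^sub>r (\<tau> q) = q\<close>, the form
    \<open>L\<^sub>i z\<close> has the same image under \<open>L\<^sub>r\<close> as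
    \<open>n\<close>.\<close>
  have zero: "div_pow g r (n - div_pow g i z) = 0"
    by (simp add: div_pow_diff z(2) div_pow_cmul \<tau> q(3))
  moreover have "n - div_pow g i z \<in> ext_deg g (int (g + i))"
    using n z(1) by (intro ext_deg_diff) (auto simp: ker_filtration_def intro: div_pow_ext_deg)
  ultimately have "n - div_pow g i z \<in> ker_filtration g i (int r - 1)" by (simp add: ker_filtration_def)
  then show "\<exists>k \<in> omega_image g i. \<exists>n' \<in> ker_filtration g i (int r - 1). n = k + n'"
    using z(1) unfolding omega_image_def by (intro bexI[of _ "div_pow g i z"] bexI[of _ "n - div_pow g i z"]) auto
qed

section \<open>The associated graded modules of the cokernel\<close>

definition coker_filtration :: "nat \<Rightarrow> nat \<Rightarrow> int \<Rightarrow> ext set set" where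
  "coker_filtration g i r = r_coset (ext_power g (g + i)) (omega_image g i) ` ker_filtration g i r"

definition gr_class :: "nat \<Rightarrow> nat \<Rightarrow> int \<Rightarrow> ext \<Rightarrow> ext set set" where
  "gr_class g i r n = coker_filtration g i (r - 1) #>\<^bsub>coker_omega g i\<^esub>
     (omega_image g i #>\<^bsub>ext_power g (g + i)\<^esub> n)"

lemma gr_class:
  fixes g i :: nat and r :: int
  assumes "i \<le> g"
  defines "G \<equiv> gr (coker_omega g i) (coker_filtration g i) r"
  shows "gmodule (Sp g) G"
    and "gr_class g i r \<in> hom (sub_gmod (ext_power g (g + i)) (ker_filtration g i r)) G"
    and "gr_class g i r ` ker_filtration g i r = carrier G"
    and "n \<in> ker_filtration g i r \<Longrightarrow> gr_class g i r n = \<one>\<^bsub>G\<^esub> \<longleftrightarrow>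
      (\<exists>k \<in> omega_image g i. \<exists>n' \<in> ker_filtration g i (r - 1). n = k + n')"
    and "A \<in> Sp g \<Longrightarrow> n \<in> ker_filtration g i r \<Longrightarrow> act G A (gr_class g i r n) = gr_class g i r (ext_act A n)"
proof -
  note pr = gmodule.gr_projection[OF gmodule_ext_power subgmod_omega_image subgmod_ker_filtration[of g i r]
      subgmod_ker_filtration[of g i "r - 1"]]
  have le: "ker_filtration g i (r - 1) \<subseteq> ker_filtration g i r" by (rule ker_filtration_mono) simp
  have G: "G = quot_gmod (sub_gmod (quot_gmod (ext_power g (g + i)) (omega_image g i))
      (r_coset (ext_power g (g + i)) (omega_image g i) ` ker_filtration g i r))
      (r_coset (ext_power g (g + i)) (omega_image g i) ` ker_filtration g i (r - 1))"
    by (simp add: G_def gr_def coker_omega_eq[OF assms(1)] coker_filtration_def)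
  have cl: "gr_class g i r = (\<lambda>n. r_coset (ext_power g (g + i)) (omega_image g i) ` ker_filtration g i (r - 1)
      #>\<^bsub>quot_gmod (ext_power g (g + i)) (omega_image g i)\<^esub> (omega_image g i #>\<^bsub>ext_power g (g + i)\<^esub> n))"
    by (simp add: gr_class_def[abs_def] coker_omega_eq[OF assms(1)] coker_filtration_def)
  show "gmodule (Sp g) G" unfolding G by (rule pr(1)[OF le])
  show "gr_class g i r \<in> hom (sub_gmod (ext_power g (g + i)) (ker_filtration g i r)) G"
    unfolding G cl by (rule pr(2)[OF le])
  show "gr_class g i r ` ker_filtration g i r = carrier G"
    unfolding G cl by (rule pr(3)[OF le])
  show "gr_class g i r n = \<one>\<^bsub>G\<^esub> \<longleftrightarrow> (\<exists>k \<in> omega_image g i. \<exists>n' \<in> ker_filtration g i (r - 1). n = k + n')"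
    if "n \<in> ker_filtration g i r"
    using pr(4)[OF le that] unfolding G cl by (simp only: ext_power_simps)
  show "act G A (gr_class g i r n) = gr_class g i r (ext_act A n)" if "A \<in> Sp g" "n \<in> ker_filtration g i r"
    using pr(5)[OF le that] unfolding G cl by (simp only: ext_power_simps)
qed

lemma gr_trivial:
  assumes "i \<le> g" "ker_filtration g i (r - 1) = ker_filtration g i r"
  shows "trivial_group (gr (coker_omega g i) (coker_filtration g i) r)"
proof -
  let ?G = "gr (coker_omega g i) (coker_filtration g i) r"
  interpret G: gmodule "Sp g" ?G by (rule gr_class(1)[OF assms(1)])
  have "0 \<in> omega_image g i" unfolding omega_image_def by (rule image_eqI[of _ _ 0]) simp_all
  then have "\<exists>k \<in> omega_image g i. \<exists>n' \<in> ker_filtration g i (r - 1). n = k + n'" if "n \<in> ker_filtration g i r" for n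
    using that assms(2) by (intro bexI[of _ 0] bexI[of _ n]) simp_all
  then have "gr_class g i r n = \<one>\<^bsub>?G\<^esub>" if "n \<in> ker_filtration g i r" for n
    using gr_class(4)[OF assms(1) that] that by blast
  then have "gr_class g i r ` ker_filtration g i r \<subseteq> {\<one>\<^bsub>?G\<^esub>}" by blast
  then have "carrier ?G \<subseteq> {\<one>\<^bsub>?G\<^esub>}" by (simp only: gr_class(3)[OF assms(1)])
  then show ?thesis using G.is_group G.one_closed by (auto simp: trivial_group_def)
qed

lemma subgmod_coker_filtration:
  assumes "i \<le> g"
  shows "subgmod (Sp g) (coker_filtration g i r) (coker_omega g i)"
  unfolding coker_filtration_def coker_omega_eq[OF assms]
  by (rule gmodule.subgmod_image_r_coset[OF gmodule_ext_power subgmod_omega_image subgmod_ker_filtration])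

lemma gmod_filtration_coker:
  assumes "i \<le> g"
  shows "gmod_filtration (Sp g) (coker_omega g i) ((g - i) div 2) (coker_filtration g i)"
  unfolding gmod_filtration_def
proof (intro conjI allI impI)
  fix r
  show "subgmod (Sp g) (coker_filtration g i r) (coker_omega g i)"
    by (rule subgmod_coker_filtration[OF assms])
  show "coker_filtration g i (r - 1) \<subseteq> coker_filtration g i r"
    unfolding coker_filtration_def by (intro image_mono ker_filtration_mono) simp
  show "coker_filtration g i r = carrier (coker_omega g i)" if "r \<ge> int ((g - i) div 2)"
    by (simp add: coker_filtration_def ker_filtration_top[OF assms that] coker_omega_eq[OF assms])
  interpret M: gmodule "Sp g" "ext_power g (g + i)" by (rule gmodule_ext_power)
  have "omega_image g i \<subseteq> carrier (ext_power g (g + i))" by (rule M.subgmod_subset[OF subgmod_omega_image])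
  then show "coker_filtration g i r = {\<one>\<^bsub>coker_omega g i\<^esub>}" if "r \<le> - 1"
    using that M.coset_mult_one by (simp add: coker_filtration_def ker_filtration_neg coker_omega_eq[OF assms])
qed

text \<open>Both modules are quotients of step \<open>r\<close> of the kernel filtration: one by
  \<open>gr_class\<close>, the other by \<open>L\<^sub>r\<close> followed by the inverse of
  \<open>L\<^sub>j\<close> from \<open>Q\<close> to the primitive forms. The kernels agree by
  \<open>ker_filtration_kernel\<close>.\<close>

lemma gr_isomorphic:
  assumes "i \<le> g" "r \<le> (g - i) div 2"
  shows "gmod_isomorphic (Sp g) (gr (coker_omega g i) (coker_filtration g i) (int r))
    (mod_gmod (primitive g (g - i - 2 * r)) ((r + i) choose i))"
proof -
  define j where "j = i + 2 * r"
  define P where "P = primitives g (g - j)"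
  define c where "c = (r + i) choose i"
  define cP where "cP = (\<lambda>x. frag_cmul (int c) x) ` P"
  have j: "j \<le> g" using assms by (simp add: j_def)
  have c: "c \<noteq> 0" by (simp add: c_def)
  have deg: "int g + int j = int g + int i + 2 * int r" by (simp add: j_def)
  have P_iff: "p \<in> P \<longleftrightarrow> p \<in> ext_deg g (int g - int j) \<and> div_pow g (Suc j) p = 0" for p
    using j by (simp add: P_def primitives_def of_nat_diff)
  interpret P: gmodule "Sp g" "primitive g (g - j)" by (rule gmodule_primitive)
  have sub: "subgmod (Sp g) cP (primitive g (g - j))"
    unfolding cP_def P_def by (rule subgmod_multiples)
  have C: "mod_gmod (primitive g (g - i - 2 * r)) ((r + i) choose i) = quot_gmod (primitive g (g - j)) cP"
    by (simp add: mod_gmod_def cP_def P_def c_def j_def)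
  interpret C: gmodule "Sp g" "quot_gmod (primitive g (g - j)) cP" by (rule P.quot_gmodule[OF sub])
  interpret M: gmodule "Sp g" "ext_power g (g + i)" by (rule gmodule_ext_power)
  interpret A: gmodule "Sp g" "sub_gmod (ext_power g (g + i)) (ker_filtration g i (int r))"
    by (rule M.sub_gmodule[OF subgmod_ker_filtration])
  interpret G: gmodule "Sp g" "gr (coker_omega g i) (coker_filtration g i) (int r)"
    by (rule gr_class(1)[OF assms(1)])
  let ?Q = "{q \<in> ext_deg g (int g + int j). div_pow g 1 q = 0}"
  \<comment> \<open>The extreme order \<open>s = j\<close> of the section: \<open>t\<close> lands in
    degree \<open>g - j\<close> and inverts \<open>L\<^sub>j\<close> on \<open>Q\<close>.\<close>
  obtain t where t: "additive t" "\<And>q. q \<in> ?Q \<Longrightarrow> t q \<in> ext_deg g (int g - int j) \<and> div_pow g j (t q) = q"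
    using div_pow_section[of j j g] by auto
  obtain \<tau> where \<tau>: "additive \<tau>" "\<And>q. q \<in> ext_deg g (int g + int i + 2 * int r) \<Longrightarrow> div_pow g 1 q = 0 \<Longrightarrow>
      div_pow g r (\<tau> q) = q \<and> \<tau> q \<in> ext_deg g (int g + int i) \<and>
      (\<exists>z \<in> ext_deg g (int g - int i). div_pow g i z = frag_cmul (int ((r + i) choose i)) (\<tau> q))"
    using div_pow_split_section[of g i r] by blast
  have inj: "p = p'" if "p \<in> ext_deg g (int g - int j)" "p' \<in> ext_deg g (int g - int j)" "div_pow g j p = div_pow g j p'" for p p'
    using div_pow_injective[OF ext_deg_diff[OF that(1,2)], of j] that(3) by (simp add: div_pow_diff)
  have t_P: "t q \<in> P" if "q \<in> ?Q" for q
  proof -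
    have "frag_cmul (int (Suc j)) (div_pow g (Suc j) (t q)) = 0"
      using t(2)[OF that] that by (simp only: div_pow_Suc[symmetric]) simp
    then show ?thesis using t(2)[OF that] by (simp add: P_iff del: of_nat_Suc)
  qed
  have P_Q: "div_pow g j p \<in> ?Q" and P_t: "t (div_pow g j p) = p" if "p \<in> P" for p
  proof -
    show Q: "div_pow g j p \<in> ?Q"
      using that by (auto simp: P_iff div_pow_Suc simp del: of_nat_Suc One_nat_def intro: div_pow_ext_deg)
    show "t (div_pow g j p) = p"
      using inj t(2)[OF Q] that by (simp add: P_iff)
  qed
  have N_Q: "div_pow g r n \<in> ?Q" if "n \<in> ker_filtration g i (int r)" for n
    using div_pow_ker_filtration[OF that] by (simp add: deg)
  define h where "h = (\<lambda>n. cP #>\<^bsub>primitive g (g - j)\<^esub> t (div_pow g r n))"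
  note h_hom = P.r_coset_hom[OF sub]
  have P_carrier: "carrier (primitive g (g - j)) = P" by (simp add: P_def)
  show ?thesis
    unfolding C
  proof (rule gmod_isomorphic_if_same_kernel[where h = h, OF A.is_group G.is_group C.is_group gr_class(2)[OF assms(1)]])
    show "gr_class g i (int r) ` carrier (sub_gmod (ext_power g (g + i)) (ker_filtration g i (int r))) =
        carrier (gr (coker_omega g i) (coker_filtration g i) (int r))"
      by (simp add: gr_class(3)[OF assms(1)])
    show "h \<in> hom (sub_gmod (ext_power g (g + i)) (ker_filtration g i (int r))) (quot_gmod (primitive g (g - j)) cP)"
    proof (rule homI)
      fix m n assume mn: "m \<in> carrier (sub_gmod (ext_power g (g + i)) (ker_filtration g i (int r)))"
        "n \<in> carrier (sub_gmod (ext_power g (g + i)) (ker_filtration g i (int r)))"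
      have "t (div_pow g r (m + n)) = t (div_pow g r m) + t (div_pow g r n)"
        by (simp add: div_pow_add additive.add[OF t(1)])
      then show "h (m \<otimes>\<^bsub>sub_gmod (ext_power g (g + i)) (ker_filtration g i (int r))\<^esub> n) =
          h m \<otimes>\<^bsub>quot_gmod (primitive g (g - j)) cP\<^esub> h n"
        using hom_mult[OF h_hom, of "t (div_pow g r m)" "t (div_pow g r n)"] t_P[OF N_Q] mn
        by (simp add: h_def P_carrier del: primitive_simps(1) quot_gmod_simps(2))
    next
      fix n assume "n \<in> carrier (sub_gmod (ext_power g (g + i)) (ker_filtration g i (int r)))"
      then show "h n \<in> carrier (quot_gmod (primitive g (g - j)) cP)"
        using t_P[OF N_Q] by (simp add: h_def P_carrier del: primitive_simps(1))
    qed
    show "h ` carrier (sub_gmod (ext_power g (g + i)) (ker_filtration g i (int r))) = carrier (quot_gmod (primitive g (g - j)) cP)"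
    proof -
      \<comment> \<open>Surjectivity comes from the lift: \<open>\<tau> (L\<^sub>j p)\<close> lies
        in step \<open>r\<close>, and \<open>L\<^sub>r\<close> sends it back to
        \<open>L\<^sub>j p\<close>.\<close>
      have "\<exists>n \<in> ker_filtration g i (int r). t (div_pow g r n) = p" if p: "p \<in> P" for p
      proof -
        have q: "div_pow g j p \<in> ext_deg g (int g + int i + 2 * int r)" "div_pow g 1 (div_pow g j p) = 0"
          using P_Q[OF p] by (simp_all add: deg)
        note \<tau>q = \<tau>(2)[OF q]
        have "frag_cmul (int (Suc r)) (div_pow g (Suc r) (\<tau> (div_pow g j p))) = 0"
          using \<tau>q q by (simp only: div_pow_Suc[symmetric])
        then have "\<tau> (div_pow g j p) \<in> ker_filtration g i (int r)"
          using \<tau>q by (simp add: ker_filtration_def nat_add_distrib del: of_nat_Suc)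
        then show ?thesis using \<tau>q P_t[OF p] by metis
      qed
      then have "(\<lambda>n. t (div_pow g r n)) ` ker_filtration g i (int r) = P"
        using t_P[OF N_Q] by blast
      then have "r_coset (primitive g (g - j)) cP ` (\<lambda>n. t (div_pow g r n)) ` ker_filtration g i (int r) =
          r_coset (primitive g (g - j)) cP ` P" by (rule arg_cong)
      then show ?thesis
        by (simp add: h_def[abs_def] image_image P_carrier del: primitive_simps(1))
    qed
    fix n assume "n \<in> carrier (sub_gmod (ext_power g (g + i)) (ker_filtration g i (int r)))"
    then have n: "n \<in> ker_filtration g i (int r)" by simp
    have "h n = \<one>\<^bsub>quot_gmod (primitive g (g - j)) cP\<^esub> \<longleftrightarrow> t (div_pow g r n) \<in> cP"
      unfolding h_def by (rule P.r_coset_eq_one_iff[OF sub]) (simp add: P_carrier t_P[OF N_Q[OF n]] del: primitive_simps(1))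
    also have "\<dots> \<longleftrightarrow> (\<exists>q \<in> ext_deg g (int g + int i + 2 * int r). div_pow g 1 q = 0 \<and>
       div_pow g r n = frag_cmul (int ((r + i) choose i)) q)"
    proof
      assume "t (div_pow g r n) \<in> cP"
      then obtain p where p: "p \<in> P" "t (div_pow g r n) = frag_cmul (int c) p" unfolding cP_def by blast
      then have "div_pow g r n = frag_cmul (int c) (div_pow g j p)"
        using t(2)[OF N_Q[OF n]] by (metis div_pow_cmul)
      then show "\<exists>q \<in> ext_deg g (int g + int i + 2 * int r). div_pow g 1 q = 0 \<and>
          div_pow g r n = frag_cmul (int ((r + i) choose i)) q"
        using P_Q[OF p(1)] by (auto simp: deg c_def)
    next
      assume "\<exists>q \<in> ext_deg g (int g + int i + 2 * int r). div_pow g 1 q = 0 \<and>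
          div_pow g r n = frag_cmul (int ((r + i) choose i)) q"
      then obtain q where "q \<in> ?Q" "div_pow g r n = frag_cmul (int c) q" by (auto simp: deg c_def)
      then show "t (div_pow g r n) \<in> cP"
        using t_P by (simp add: cP_def additive_frag_cmul[OF t(1)])
    qed
    finally show "gr_class g i (int r) n = \<one>\<^bsub>gr (coker_omega g i) (coker_filtration g i) (int r)\<^esub> \<longleftrightarrow>
        h n = \<one>\<^bsub>quot_gmod (primitive g (g - j)) cP\<^esub>"
      using gr_class(4)[OF assms(1) n] ker_filtration_kernel[OF \<tau> n] by blast
    fix A assume A: "A \<in> Sp g"
    show "act (sub_gmod (ext_power g (g + i)) (ker_filtration g i (int r))) A n \<in>
        carrier (sub_gmod (ext_power g (g + i)) (ker_filtration g i (int r)))"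
      using A.act_closed[OF A, of n] n by simp
    show "act (gr (coker_omega g i) (coker_filtration g i) (int r)) A (gr_class g i (int r) n) =
        gr_class g i (int r) (act (sub_gmod (ext_power g (g + i)) (ker_filtration g i (int r))) A n)"
      using gr_class(5)[OF assms(1) A n] by simp
    have An: "ext_act A n \<in> ker_filtration g i (int r)" using A.act_closed[OF A, of n] n by simp
    have "n \<in> ext_deg g (int (g + i))" using n by (simp add: ker_filtration_def)
    then have "div_pow g r (ext_act A n) = ext_act A (div_pow g r n)"
      by (rule ext_act_div_pow[OF A, symmetric])
    also have "\<dots> = div_pow g j (ext_act A (t (div_pow g r n)))"
      using t(2)[OF N_Q[OF n]] ext_act_div_pow[OF A] by metis
    finally have eq: "div_pow g r (ext_act A n) = div_pow g j (ext_act A (t (div_pow g r n)))" .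
    \<comment> \<open>The section \<open>t\<close> was chosen without regard to the group. It is
      equivariant on \<open>Q\<close> because \<open>L\<^sub>j\<close> is injective in degree
      \<open>g - j\<close> and commutes with the action.\<close>
    have "t (div_pow g r (ext_act A n)) = ext_act A (t (div_pow g r n))"
      by (rule inj) (use t(2)[OF N_Q[OF n]] t(2)[OF N_Q[OF An]] eq in
          \<open>simp_all add: ext_act_ext_deg[OF _ Sp_dim_row[OF A]]\<close>)
    then show "act (quot_gmod (primitive g (g - j)) cP) A (h n) =
        h (act (sub_gmod (ext_power g (g + i)) (ker_filtration g i (int r))) A n)"
      using P.act_r_coset[OF sub A, of "t (div_pow g r n)"] t_P[OF N_Q[OF n]]
      by (simp add: h_def P_carrier del: primitive_simps(1) quot_gmod_simps(4))
  qed
qed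

text \<open>The map \<open>\<theta> = \<tau> L\<^sub>r\<close> changes a form of step
  \<open>r\<close> only by step \<open>r - 1\<close>, and it sends the kernel of the projection to
  \<open>gr\<^sub>r\<close> into the image of \<open>L\<^sub>i\<close>. Followed by the passage to
  the cokernel, it factors through \<open>gr\<^sub>r\<close> and yields the section.\<close>

lemma gr_split:
  assumes "i \<le> g"
  shows "\<exists>\<sigma> \<in> hom (gr (coker_omega g i) (coker_filtration g i) r) (sub_gmod (coker_omega g i) (coker_filtration g i r)).
    \<forall>C \<in> carrier (gr (coker_omega g i) (coker_filtration g i) r).
      coker_filtration g i (r - 1) #>\<^bsub>sub_gmod (coker_omega g i) (coker_filtration g i r)\<^esub> \<sigma> C = C"
proof -
  let ?M = "ext_power g (g + i)" and ?Q = "coker_omega g i" and ?F = "coker_filtration g i"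
  let ?N = "ker_filtration g i r" and ?\<rho> = "r_coset (ext_power g (g + i)) (omega_image g i)" and ?G = "gr ?Q ?F r"
  interpret M: gmodule "Sp g" ?M by (rule gmodule_ext_power)
  interpret N: gmodule "Sp g" "sub_gmod ?M ?N" by (rule M.sub_gmodule[OF subgmod_ker_filtration])
  interpret Q: gmodule "Sp g" ?Q
    unfolding coker_omega_eq[OF assms] by (rule M.quot_gmodule[OF subgmod_omega_image])
  interpret F: gmodule "Sp g" "sub_gmod ?Q (?F r)"
    by (rule Q.sub_gmodule[OF subgmod_coker_filtration[OF assms]])
  interpret G: gmodule "Sp g" ?G by (rule gr_class(1)[OF assms])
  have \<rho>: "?\<rho> \<in> hom ?M ?Q" unfolding coker_omega_eq[OF assms] by (rule M.r_coset_hom[OF subgmod_omega_image])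
  have \<rho>_one: "?\<rho> x = \<one>\<^bsub>?Q\<^esub> \<longleftrightarrow> x \<in> omega_image g i" if "x \<in> carrier ?M" for x
    unfolding coker_omega_eq[OF assms] by (rule M.r_coset_eq_one_iff[OF subgmod_omega_image that])
  have "\<exists>\<theta>. additive \<theta> \<and> (\<forall>n \<in> ?N. \<theta> n \<in> ?N \<and> n - \<theta> n \<in> ker_filtration g i (r - 1) \<and>
      (gr_class g i r n = \<one>\<^bsub>?G\<^esub> \<longrightarrow> \<theta> n \<in> omega_image g i))"
  proof (cases "0 \<le> r \<and> r \<le> int ((g - i) div 2)")
    case True
    then obtain s where s: "r = int s" "s \<le> (g - i) div 2" by (metis nonneg_int_cases of_nat_le_iff)
    obtain \<tau> where \<tau>: "additive \<tau>" "\<And>q. q \<in> ext_deg g (int g + int i + 2 * int s) \<Longrightarrow> div_pow g 1 q = 0 \<Longrightarrow>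
        div_pow g s (\<tau> q) = q \<and> \<tau> q \<in> ext_deg g (int g + int i) \<and>
        (\<exists>z \<in> ext_deg g (int g - int i). div_pow g i z = frag_cmul (int ((s + i) choose i)) (\<tau> q))"
      using div_pow_split_section[of g i s] by blast
    have "\<tau> (div_pow g s n) \<in> ?N \<and> n - \<tau> (div_pow g s n) \<in> ker_filtration g i (r - 1) \<and>
      (gr_class g i r n = \<one>\<^bsub>?G\<^esub> \<longrightarrow> \<tau> (div_pow g s n) \<in> omega_image g i)" if n: "n \<in> ?N" for n
    proof (intro conjI impI)
      have n': "n \<in> ker_filtration g i (int s)" using n s by simp
      note q = div_pow_ker_filtration[OF n'] and \<tau>q = \<tau>(2)[OF div_pow_ker_filtration[OF n']]
      have "frag_cmul (int (Suc s)) (div_pow g (Suc s) (\<tau> (div_pow g s n))) = 0"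
        using \<tau>q q by (simp only: div_pow_Suc[symmetric])
      then show \<tau>n: "\<tau> (div_pow g s n) \<in> ?N"
        using \<tau>q s by (simp add: ker_filtration_def nat_add_distrib del: of_nat_Suc)
      then have "n - \<tau> (div_pow g s n) \<in> ext_deg g (int (g + i))"
        using n by (intro ext_deg_diff) (simp_all add: ker_filtration_def)
      then show "n - \<tau> (div_pow g s n) \<in> ker_filtration g i (r - 1)"
        using \<tau>q s by (simp add: ker_filtration_def div_pow_diff)
      assume "gr_class g i r n = \<one>\<^bsub>?G\<^esub>"
      then obtain q' where q': "q' \<in> ext_deg g (int g + int i + 2 * int s)" "div_pow g 1 q' = 0"
        "div_pow g s n = frag_cmul (int ((s + i) choose i)) q'"
        using gr_class(4)[OF assms n] ker_filtration_kernel[OF \<tau> n'] s by auto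
      \<comment> \<open>By additivity the binomial coefficient comes out, and this multiple of
        \<open>\<tau> q'\<close> lies in the image of \<open>L\<^sub>i\<close>: the property for
        which \<open>\<tau>\<close> was built.\<close>
      then have "\<tau> (div_pow g s n) = frag_cmul (int ((s + i) choose i)) (\<tau> q')"
        by (simp add: additive_frag_cmul[OF \<tau>(1)])
      then show "\<tau> (div_pow g s n) \<in> omega_image g i"
        using \<tau>(2)[OF q'(1,2)] unfolding omega_image_def by (metis imageI)
    qed
    then show ?thesis using additive_compose[OF \<tau>(1) additive_div_pow] by blast
  next
    case False
    \<comment> \<open>Outside the range consecutive steps coincide, so \<open>gr\<^sub>r\<close> is
      zero and the zero map serves as \<open>\<theta>\<close>.\<close>
    then have "ker_filtration g i (r - 1) = ?N" using ker_filtration_neg ker_filtration_top[OF assms] by (cases "r < 0") auto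
    moreover have "0 \<in> omega_image g i" unfolding omega_image_def by (rule image_eqI[of _ _ 0]) simp_all
    moreover have "0 \<in> ?N" by (simp add: ker_filtration_def)
    ultimately show ?thesis by (intro exI[of _ "\<lambda>_. 0"]) (simp add: additive_def)
  qed
  then obtain \<theta> where \<theta>: "additive \<theta>" "\<And>n. n \<in> ?N \<Longrightarrow> \<theta> n \<in> ?N" "\<And>n. n \<in> ?N \<Longrightarrow> n - \<theta> n \<in> ker_filtration g i (r - 1)"
      "\<And>n. n \<in> ?N \<Longrightarrow> gr_class g i r n = \<one>\<^bsub>?G\<^esub> \<Longrightarrow> \<theta> n \<in> omega_image g i"
    by blast
  have N_carrier: "n \<in> carrier ?M" if "n \<in> ?N" for n using that by (simp add: ker_filtration_def)
  have lift: "(\<lambda>n. ?\<rho> (\<theta> n)) \<in> hom (sub_gmod ?M ?N) (sub_gmod ?Q (?F r))"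
  proof (rule homI)
    fix m n assume "m \<in> carrier (sub_gmod ?M ?N)" "n \<in> carrier (sub_gmod ?M ?N)"
    then show "?\<rho> (\<theta> (m \<otimes>\<^bsub>sub_gmod ?M ?N\<^esub> n)) = ?\<rho> (\<theta> m) \<otimes>\<^bsub>sub_gmod ?Q (?F r)\<^esub> ?\<rho> (\<theta> n)"
      using hom_mult[OF \<rho>, of "\<theta> m" "\<theta> n"] \<theta>(2) N_carrier
      by (simp add: additive.add[OF \<theta>(1)] del: quot_gmod_simps(2))
  qed (use \<theta>(2) in \<open>auto simp: coker_filtration_def\<close>)
  have onto: "gr_class g i r ` carrier (sub_gmod ?M ?N) = carrier ?G" by (simp add: gr_class(3)[OF assms])
  have ker: "?\<rho> (\<theta> n) = \<one>\<^bsub>sub_gmod ?Q (?F r)\<^esub>"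
    if "n \<in> carrier (sub_gmod ?M ?N)" "gr_class g i r n = \<one>\<^bsub>?G\<^esub>" for n
    using that \<rho>_one \<theta>(2,4) N_carrier by simp
  obtain \<sigma> where \<sigma>: "\<sigma> \<in> hom ?G (sub_gmod ?Q (?F r))" "\<And>n. n \<in> carrier (sub_gmod ?M ?N) \<Longrightarrow> \<sigma> (gr_class g i r n) = ?\<rho> (\<theta> n)"
    using hom_lift[OF N.is_group G.is_group F.is_group gr_class(2)[OF assms] onto lift ker] by blast
  show ?thesis
  proof (rule bexI[OF _ \<sigma>(1)], rule ballI)
    fix C assume "C \<in> carrier ?G"
    then obtain n where n: "n \<in> ?N" "C = gr_class g i r n" using gr_class(3)[OF assms, of r] by blast
    have n': "n - \<theta> n \<in> ?N" using \<theta>(3)[OF n(1)] ker_filtration_mono[of "r - 1" r g i] by auto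
    have "0 \<in> omega_image g i" unfolding omega_image_def by (rule image_eqI[of _ _ 0]) simp_all
    \<comment> \<open>The difference lies in step \<open>r - 1\<close>, so \<open>\<theta> n\<close>
      represents the same class as \<open>n\<close>.\<close>
    then have "gr_class g i r (n - \<theta> n) = \<one>\<^bsub>?G\<^esub>"
      using gr_class(4)[OF assms n'] \<theta>(3)[OF n(1)] by (metis add_0)
    moreover have "gr_class g i r (\<theta> n + (n - \<theta> n)) = gr_class g i r (\<theta> n) \<otimes>\<^bsub>?G\<^esub> gr_class g i r (n - \<theta> n)"
      using hom_mult[OF gr_class(2)[OF assms, of r], of "\<theta> n" "n - \<theta> n"] \<theta>(2)[OF n(1)] n' by simp
    moreover have "gr_class g i r (\<theta> n) \<in> carrier ?G"
      using gr_class(3)[OF assms, of r] \<theta>(2)[OF n(1)] by blast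
    ultimately have "gr_class g i r (\<theta> n) = C" using n(2) by simp
    then show "?F (r - 1) #>\<^bsub>sub_gmod ?Q (?F r)\<^esub> \<sigma> C = C"
      using \<sigma>(2)[of n] n by (simp add: gr_class_def)
  qed
qed

theorem theorem1p2:
  fixes g i :: nat
  assumes "i \<le> g"
  shows "\<exists>(n :: nat) (F :: int \<Rightarrow> ext set set).
    gmod_filtration (Sp g) (coker_omega g i) n F \<and>
    Z_split (coker_omega g i) F \<and>
    (\<forall>r :: nat. r \<le> (g - i) div 2 \<longrightarrow>
       gmod_isomorphic (Sp g) (gr (coker_omega g i) F (int r))
         (mod_gmod (primitive g (g - i - 2 * r)) ((r + i) choose i))) \<and>
    (\<forall>r :: int. r < 0 \<or> r > int ((g - i) div 2) \<longrightarrow>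
       trivial_group (gr (coker_omega g i) F r))"
proof (intro exI conjI allI impI)
  show "gmod_filtration (Sp g) (coker_omega g i) ((g - i) div 2) (coker_filtration g i)"
    by (rule gmod_filtration_coker[OF assms])
  show "Z_split (coker_omega g i) (coker_filtration g i)"
    unfolding Z_split_def using gr_split[OF assms] by blast
  show "gmod_isomorphic (Sp g) (gr (coker_omega g i) (coker_filtration g i) (int r))
      (mod_gmod (primitive g (g - i - 2 * r)) ((r + i) choose i))" if "r \<le> (g - i) div 2" for r
    by (rule gr_isomorphic[OF assms that])
  fix r :: int assume "r < 0 \<or> r > int ((g - i) div 2)"
  then have "ker_filtration g i (r - 1) = ker_filtration g i r"
    using ker_filtration_neg ker_filtration_top[OF assms] by (cases "r < 0") auto
  then show "trivial_group (gr (coker_omega g i) (coker_filtration g i) r)"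
    by (rule gr_trivial[OF assms])
qed

end
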